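(* Let $f:\mathbb{R}^n\to\mathbb{R}$ be locally Lipschitz and continuously differentiable on an open set $D$ of full measure in $\mathbb{R}^n$, and suppose that $f$ is bounded below, with $f_l\in\mathbb{R}$ a lower bound for $f$. Consider the GSI algorithm with the limited backtracking Armijo line search LBALS, applied to $f$ with $\nu_0=\nu_{opt}=:\nu>0$, $\varepsilon_0=\varepsilon_{opt}=:\varepsilon>0$ and $m:=4n$. Then, with probability 1, the algorithm terminates after finitely many serious iterations, and their number $k_{\max}\ge0$ satisfies $$k_{\max}\le\Big\lfloor\frac{f(\mathbf{x}_0)-f_l}{c\,\nu\,\min\{1,\gamma\varepsilon/3\}}\Big\rfloor+1.$$
   Context: $\lVert\cdot\rVert$ is the Euclidean norm, $B_1$ is the closed unit ball of $\mathbb{R}^n$, $\mathrm{co}$ denotes convex hull. Given a point $\mathbf{x}$ and sampled points $\mathbf{s}_0:=\mathbf{x},\mathbf{s}_1,\dots,\mathbf{s}_m\in B(\mathbf{x},\varepsilon)$ (the closed ball of radius $\varepsilon$ about $\mathbf{x}$), at all of which $f$ is differentiable: - $G^m_\varepsilon(\mathbf{x}):=\mathrm{co}\{\nabla f(\mathbf{s}_0),\dots,\nabla f(\mathbf{s}_m)\}$ and $\mathbf{g}^{s}_\varepsilon$ is its element of minimum norm; - $\mathbf{g}^{I}_\varepsilon\in\mathbb{R}^n$ has $i$-th component $g^{I}_{\varepsilon,i}:=\operatorname{argmin}\{|g| : g\in\mathrm{co}\{\frac{\partial f}{\partial x_i}(\mathbf{s}_j):j=0,\dots,m\}\}$, $i=1,\dots,n$.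 Line search LBALS$(\mathbf{x},\mathbf{g},\mathbf{d},\varepsilon,\gamma,c)$: start with $t:=1$; while $t>\min\{1,\gamma\varepsilon/3\}$: if $f(\mathbf{x}+t\mathbf{d})-f(\mathbf{x})<-c\,t\lVert\mathbf{g}\rVert$ return $t$, otherwise set $t:=\gamma t$. If the while loop ends without returning, return $0$. GSI algorithm with LBALS. Inputs: a starting point $\mathbf{x}_0\in\mathbb{R}^n$ at which $f$ is differentiable, initial sampling radius $\varepsilon_0>0$, initial stationarity tolerance $\nu_0>0$, sample size $m\in\mathbb{N}$, tolerances $\nu_{opt},\varepsilon_{opt}\ge0$, reduction factors $\theta,\mu\in(0,1)$, line search parameters $\gamma,c\in(0,1)$. Set $k:=0$. While $\nu_k\ge\nu_{opt}$ or $\varepsilon_k\ge\varepsilon_{opt}$, do: (1) Sample $\mathbf{u}_{k1},\dots,\mathbf{u}_{km}$ independently and uniformly from $B_1$ and set $\mathbf{s}_{k0}:=\mathbf{x}_k$, $\mathbf{s}_{kj}:=\mathbf{x}_k+\varepsilon_k\mathbf{u}_{kj}$ for $j=1,\dots,m$. If $f$ is not differentiable at some $\mathbf{s}_{kj}$, stop. (2) Using these sampled points, compute $\mathbf{g}^{I}_{\varepsilon_k}$ for $G^m_{\varepsilon_k}(\mathbf{x}_k)$ and set $\mathbf{g}_k:=\mathbf{g}^{I}_{\varepsilon_k}$. If $\lVert\mathbf{g}_k\rVert\le\nu_k$, compute $\mathbf{g}^{s}_{\varepsilon_k}$ and set $\mathbf{g}_k:=\mathbf{g}^{s}_{\varepsilon_k}$.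 (3) If (now) $\lVert\mathbf{g}_k\rVert\le\nu_k$, set $\nu_{k+1}:=\theta\nu_k$, $\varepsilon_{k+1}:=\mu\varepsilon_k$, $\mathbf{x}_{k+1}:=\mathbf{x}_k$, $k:=k+1$ and go to the next pass of the loop. (4) Otherwise set $\mathbf{d}_k:=-\lVert\mathbf{g}_k\rVert^{-1}\mathbf{g}_k$, let $t_k$ be the value returned by LBALS$(\mathbf{x}_k,\mathbf{g}_k,\mathbf{d}_k,\varepsilon_k,\gamma,c)$, and set $\mathbf{x}_{k+1}:=\mathbf{x}_k+t_k\mathbf{d}_k$. (5) If $f$ is not differentiable at $\mathbf{x}_{k+1}$, find a point $\hat{\mathbf{x}}$ at which $f$ is differentiable and which satisfies $f(\hat{\mathbf{x}})-f(\mathbf{x}_k)<-c\,t_k\lVert\mathbf{g}_k\rVert$ and $\lVert\mathbf{x}_k+t_k\mathbf{d}_k-\hat{\mathbf{x}}\rVert\le\min\{t_k,\varepsilon_k\}$, and set $\mathbf{x}_{k+1}:=\hat{\mathbf{x}}$. (6) Set $\nu_{k+1}:=\nu_k$, $\varepsilon_{k+1}:=\varepsilon_k$, $k:=k+1$. An iteration in which the line search is performed is called a serious iteration if $t_k\ne0$ and a null iteration if $t_k=0$.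
   Formalization: Termination is claimed only when γε < 3: if γε ≥ 3, LBALS always returns 0 and the algorithm can run through null iterations forever (f = 2ν·max(y₁,−R), R > ε, x₀ = 0); finiteness of the number of serious iterations and the bound hold for all γ, ε. *)

theory Defs
  imports "HOL-Probability.Probability"
begin

definition partial_derivative :: "(real^'n \<Rightarrow> real) \<Rightarrow> 'n \<Rightarrow> real^'n \<Rightarrow> real" where
  "partial_derivative f i x = deriv (\<lambda>h. f (x + h *\<^sub>R axis i 1)) 0"

definition gradient :: "(real^'n \<Rightarrow> real) \<Rightarrow> real^'n \<Rightarrow> real^'n" where
  "gradient f x = (\<chi> i. partial_derivative f i x)"

definition sample_point :: "real^'n \<Rightarrow> real \<Rightarrow> (nat \<Rightarrow> real^'n) \<Rightarrow> nat \<Rightarrow> real^'n" where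
  "sample_point x \<epsilon> u j = (if j = 0 then x else x + \<epsilon> *\<^sub>R u j)"

definition gradient_hull :: "(real^'n \<Rightarrow> real) \<Rightarrow> nat \<Rightarrow> (nat \<Rightarrow> real^'n) \<Rightarrow> (real^'n) set" where
  "gradient_hull f m s = convex hull ((\<lambda>j. gradient f (s j)) ` {0..m})"

definition g_std :: "(real^'n \<Rightarrow> real) \<Rightarrow> nat \<Rightarrow> (nat \<Rightarrow> real^'n) \<Rightarrow> real^'n" where
  "g_std f m s = arg_min_on norm (gradient_hull f m s)"

definition g_interval :: "(real^'n \<Rightarrow> real) \<Rightarrow> nat \<Rightarrow> (nat \<Rightarrow> real^'n) \<Rightarrow> real^'n" where
  "g_interval f m s =
     (\<chi> i. arg_min_on abs (convex hull ((\<lambda>j. partial_derivative f i (s j)) ` {0..m})))"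

definition gsi_vector :: "(real^'n \<Rightarrow> real) \<Rightarrow> nat \<Rightarrow> (nat \<Rightarrow> real^'n) \<Rightarrow> real \<Rightarrow> real^'n" where
  "gsi_vector f m s \<nu> =
     (if norm (g_interval f m s) \<le> \<nu> then g_std f m s else g_interval f m s)"

text \<open>The while loop of the line search, from the current trial step \<open>t\<close>. The guard is tested before
  the first trial step \<open>t = 1\<close>, so for \<open>\<gamma> * \<epsilon> \<ge> 3\<close> the line search always returns \<open>0\<close>.\<close>

partial_function (tailrec) lbals_loop ::
    "(real^'n \<Rightarrow> real) \<Rightarrow> real^'n \<Rightarrow> real^'n \<Rightarrow> real^'n \<Rightarrow> real \<Rightarrow> real \<Rightarrow> real \<Rightarrow> real \<Rightarrow> real" where
  "lbals_loop f x g d tmin \<gamma> c t =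
     (if t > tmin
      then if f (x + t *\<^sub>R d) - f x < - (c * t * norm g) then t
           else lbals_loop f x g d tmin \<gamma> c (\<gamma> * t)
      else 0)"

definition lbals ::
    "(real^'n \<Rightarrow> real) \<Rightarrow> real^'n \<Rightarrow> real^'n \<Rightarrow> real^'n \<Rightarrow> real \<Rightarrow> real \<Rightarrow> real \<Rightarrow> real" where
  "lbals f x g d \<epsilon> \<gamma> c = lbals_loop f x g d (min 1 (\<gamma> * \<epsilon> / 3)) \<gamma> c 1"

text \<open>\<open>stopped\<close> records the abnormal stop caused by a sample point at which \<open>f\<close> is not
  differentiable.\<close>

record 'v gsi_state =
  iterate :: 'v
  radius :: real
  tolerance :: real
  stopped :: bool

definition gsi_continues :: "real \<Rightarrow> real \<Rightarrow> 'v gsi_state \<Rightarrow> bool" where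
  "gsi_continues \<nu>opt \<epsilon>opt \<sigma> \<longleftrightarrow> \<not> stopped \<sigma> \<and> (tolerance \<sigma> \<ge> \<nu>opt \<or> radius \<sigma> \<ge> \<epsilon>opt)"

text \<open>One pass of the main loop, with sample directions \<open>u 1, \<dots>, u m\<close> in the unit ball. It is a relation
  because the replacement of a nondifferentiable new iterate is only required to exist with the stated
  properties. Once the algorithm has ended, the state is kept unchanged.\<close>

definition gsi_step ::
    "(real^'n \<Rightarrow> real) \<Rightarrow> nat \<Rightarrow> real \<Rightarrow> real \<Rightarrow> real \<Rightarrow> real \<Rightarrow> real \<Rightarrow> real \<Rightarrow> (nat \<Rightarrow> real^'n) \<Rightarrow>
     (real^'n) gsi_state \<Rightarrow> (real^'n) gsi_state \<Rightarrow> bool" where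
  "gsi_step f m \<nu>opt \<epsilon>opt \<theta> \<mu> \<gamma> c u \<sigma> \<sigma>' \<longleftrightarrow>
     (let x = iterate \<sigma>; \<epsilon> = radius \<sigma>; \<nu> = tolerance \<sigma>;
          s = sample_point x \<epsilon> u;
          g = gsi_vector f m s \<nu>;
          d = - (inverse (norm g) *\<^sub>R g);
          t = lbals f x g d \<epsilon> \<gamma> c;
          y = x + t *\<^sub>R d
      in
        if \<not> gsi_continues \<nu>opt \<epsilon>opt \<sigma> then \<sigma>' = \<sigma>
        else if \<exists>j\<in>{0..m}. \<not> f differentiable (at (s j)) then \<sigma>' = \<sigma>\<lparr>stopped := True\<rparr>
        else if norm g \<le> \<nu> then \<sigma>' = \<sigma>\<lparr>tolerance := \<theta> * \<nu>, radius := \<mu> * \<epsilon>\<rparr>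
        else if f differentiable (at y) then \<sigma>' = \<sigma>\<lparr>iterate := y\<rparr>
        else \<exists>z. f differentiable (at z) \<and> f z - f x < - (c * t * norm g) \<and>
                 norm (y - z) \<le> min t \<epsilon> \<and> \<sigma>' = \<sigma>\<lparr>iterate := z\<rparr>)"

definition gsi_serious ::
    "(real^'n \<Rightarrow> real) \<Rightarrow> nat \<Rightarrow> real \<Rightarrow> real \<Rightarrow> real \<Rightarrow> real \<Rightarrow> (nat \<Rightarrow> real^'n) \<Rightarrow>
     (real^'n) gsi_state \<Rightarrow> bool" where
  "gsi_serious f m \<nu>opt \<epsilon>opt \<gamma> c u \<sigma> \<longleftrightarrow>
     (let x = iterate \<sigma>; \<epsilon> = radius \<sigma>; \<nu> = tolerance \<sigma>;
          s = sample_point x \<epsilon> u;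
          g = gsi_vector f m s \<nu>;
          d = - (inverse (norm g) *\<^sub>R g)
      in
        gsi_continues \<nu>opt \<epsilon>opt \<sigma> \<and> (\<forall>j\<in>{0..m}. f differentiable (at (s j))) \<and>
        norm g > \<nu> \<and> lbals f x g d \<epsilon> \<gamma> c \<noteq> 0)"

text \<open>\<open>u k j\<close> is the \<open>j\<close>-th sample direction of iteration \<open>k\<close>.\<close>

definition gsi_run ::
    "(real^'n \<Rightarrow> real) \<Rightarrow> real^'n \<Rightarrow> real \<Rightarrow> real \<Rightarrow> nat \<Rightarrow> real \<Rightarrow> real \<Rightarrow> real \<Rightarrow> real \<Rightarrow> real \<Rightarrow> real \<Rightarrow>
     (nat \<Rightarrow> nat \<Rightarrow> real^'n) \<Rightarrow> (nat \<Rightarrow> (real^'n) gsi_state) \<Rightarrow> bool" where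
  "gsi_run f x0 \<epsilon>0 \<nu>0 m \<nu>opt \<epsilon>opt \<theta> \<mu> \<gamma> c u \<sigma> \<longleftrightarrow>
     \<sigma> 0 = \<lparr>iterate = x0, radius = \<epsilon>0, tolerance = \<nu>0, stopped = False\<rparr> \<and>
     (\<forall>k. gsi_step f m \<nu>opt \<epsilon>opt \<theta> \<mu> \<gamma> c (u k) (\<sigma> k) (\<sigma> (Suc k)))"

text \<open>Termination through the stopping criterion of the main loop; an abnormal stop does not count.\<close>

definition gsi_terminates :: "real \<Rightarrow> real \<Rightarrow> (nat \<Rightarrow> 'v gsi_state) \<Rightarrow> bool" where
  "gsi_terminates \<nu>opt \<epsilon>opt \<sigma> \<longleftrightarrow>
     (\<exists>k. \<not> stopped (\<sigma> k) \<and> tolerance (\<sigma> k) < \<nu>opt \<and> radius (\<sigma> k) < \<epsilon>opt)"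

end

(* Along a serious step f drops by more than c nu min(1, gamma eps / 3), so boundedness from below
   limits the number of serious steps for every outcome; probability is only needed for termination.

   Averaging f over small balls yields a mean value inequality which only involves gradients at points
   of D. Hence, if the vector g is almost a minimum norm element for all gradients in the ball of radius
   eps (respectively for their bounding box), the Armijo condition holds at every step length up to
   eps / 3, and the line search tries such a step length before giving up. For each x, g is such a vector
   on a nonempty open set of sample directions. Almost surely the samples visit all products of basic
   open sets infinitely often, simultaneously, so however the last iterate depends on the samples,
   only finitely many null iterations can follow the last serious one. *)

theory Submission
  imports Defs
begin

subsection \<open>Gradients and a mean value inequality\<close>

text \<open>A segment from \<open>x\<close> can lie entirely outside \<open>D\<close>, so a mean
  value theorem along it cannot be fed with gradients at points of \<open>D\<close>; but almost
  every parallel translate of each of its points lies in \<open>D\<close>, which is why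
  \<open>f\<close> is averaged first. The gradients near \<open>x\<close> are bounded by a Lipschitz
  constant but need not attain extreme values, so finitely many of them can only be nearly optimal.
  The gap between \<open>c\<close> and 1, multiplied by \<nu>^2 because \<open>norm g\<close>
  exceeds \<nu>, pays for all errors. Caratheodory's theorem limits the number of target gradients
  for the hull, the two ends of each coordinate interval limit it for the box. Since the initial
  tolerances are also the final ones, the first reduction ends the loop. While it runs, radius and
  tolerance are constant, so serious steps have a uniform drop and the same open sets can be aimed
  at in every pass. Termination is stated for \<gamma> * \<epsilon> < 3 because otherwise the guard
  of the line search fails at t = 1 and null iterations may go on forever.\<close>

lemma partial_derivative_eq:
  assumes "(f has_derivative f') (at y)"
  shows "partial_derivative f i y = f' (axis i 1)"
proof -
  have 1: "((\<lambda>h::real. y + h *\<^sub>R axis i 1) has_derivative (\<lambda>h. h *\<^sub>R axis i 1)) (at 0)"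
    by (auto intro!: derivative_eq_intros)
  have 2: "(f has_derivative f') (at (y + 0 *\<^sub>R axis i 1))"
    using assms by simp
  have "((\<lambda>h. f (y + h *\<^sub>R axis i 1)) has_derivative (\<lambda>h. f' (h *\<^sub>R axis i 1))) (at 0)"
    using has_derivative_compose[OF 1 2] .
  moreover have "(\<lambda>h. f' (h *\<^sub>R axis i 1)) = (\<lambda>h. f' (axis i 1) * h)"
    using linear_scale[OF has_derivative_linear[OF assms]] by (auto simp: mult.commute)
  ultimately have "((\<lambda>h. f (y + h *\<^sub>R axis i 1)) has_field_derivative f' (axis i 1)) (at 0)"
    by (simp add: has_field_derivative_def)
  then show ?thesis
    by (simp add: partial_derivative_def DERIV_imp_deriv)
qed

text \<open>\<open>gradient\<close> only collects partial derivatives; total differentiability and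
  linearity make it represent the derivative in all directions.\<close>

lemma has_derivative_gradient:
  assumes "f differentiable (at y)"
  shows "(f has_derivative (\<lambda>h. gradient f y \<bullet> h)) (at y)"
proof -
  obtain f' where f': "(f has_derivative f') (at y)"
    using assms by (auto simp: differentiable_def)
  have "f' h = gradient f y \<bullet> h" for h
  proof -
    have "f' h = f' (\<Sum>i\<in>UNIV. h $ i *\<^sub>R axis i 1)"
      by (subst basis_expansion[of h, symmetric]) (simp add: scalar_mult_eq_scaleR)
    also have "\<dots> = (\<Sum>i\<in>UNIV. h $ i * f' (axis i 1))"
      using has_derivative_linear[OF f'] by (simp add: linear_sum linear_scale)
    also have "\<dots> = gradient f y \<bullet> h"
      by (simp add: inner_vec_def gradient_def partial_derivative_eq[OF f'] mult.commute)
    finally show ?thesis .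
  qed
  with f' show ?thesis
    by (metis (no_types, lifting) ext)
qed

lemma DERIV_along_line:
  assumes "f differentiable (at y)"
  shows "((\<lambda>s. f (y + s *\<^sub>R d)) has_real_derivative gradient f y \<bullet> d) (at 0)"
proof -
  have 1: "((\<lambda>h::real. y + h *\<^sub>R d) has_derivative (\<lambda>h. h *\<^sub>R d)) (at 0)"
    by (auto intro!: derivative_eq_intros)
  have 2: "(f has_derivative (\<lambda>h. gradient f y \<bullet> h)) (at (y + 0 *\<^sub>R d))"
    using has_derivative_gradient[OF assms] by simp
  show ?thesis
    using has_derivative_compose[OF 1 2] by (simp add: has_field_derivative_def mult_commute_abs)
qed

text \<open>The difference quotient in the direction of the gradient itself tends to the squared
  norm of the gradient, while the Lipschitz condition bounds it by \<open>L\<close> times that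
  norm.\<close>

lemma norm_gradient_le:
  assumes "L-lipschitz_on S f" "open S" "y \<in> S" "f differentiable (at y)"
  shows "norm (gradient f y) \<le> L"
proof -
  let ?d = "gradient f y"
  have L: "0 \<le> L" using assms(1) by (rule lipschitz_on_nonneg)
  have "((\<lambda>h. (f (y + h *\<^sub>R ?d) - f y) / h) \<longlongrightarrow> ?d \<bullet> ?d) (at 0)"
    using DERIV_along_line[OF assms(4), of ?d] by (simp add: DERIV_def)
  moreover have "\<forall>\<^sub>F h in at 0. (f (y + h *\<^sub>R ?d) - f y) / h \<le> L * norm ?d"
  proof -
    have "((\<lambda>h. y + h *\<^sub>R ?d) \<longlongrightarrow> y + 0 *\<^sub>R ?d) (at (0::real))"
      by (intro tendsto_intros)
    then have "\<forall>\<^sub>F h::real in at 0. y + h *\<^sub>R ?d \<in> S"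
      using assms(2,3) by (auto dest: topological_tendstoD)
    then show ?thesis
    proof (rule eventually_mono)
      fix h :: real assume h: "y + h *\<^sub>R ?d \<in> S"
      have "\<bar>f (y + h *\<^sub>R ?d) - f y\<bar> \<le> L * norm (h *\<^sub>R ?d)"
        using lipschitz_onD[OF assms(1) h assms(3)] by (simp add: dist_norm)
      then have "\<bar>(f (y + h *\<^sub>R ?d) - f y) / h\<bar> \<le> L * norm ?d" if "h \<noteq> 0"
        using that by (simp add: abs_divide divide_le_eq mult.commute mult.left_commute)
      then show "(f (y + h *\<^sub>R ?d) - f y) / h \<le> L * norm ?d"
        using L abs_ge_self[of "(f (y + h *\<^sub>R ?d) - f y) / h"] by (cases "h = 0") (simp, linarith)
    qed
  qed
  ultimately have "?d \<bullet> ?d \<le> L * norm ?d"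
    by (rule tendsto_upperbound) simp
  then show ?thesis
    using L by (cases "?d = 0") (auto simp: power2_norm_eq_inner[symmetric] power2_eq_square)
qed

lemma locally_lipschitz_compact:
  fixes f :: "'a::metric_space \<Rightarrow> real"
  assumes "\<And>x. \<exists>r>0. \<exists>L. L-lipschitz_on (ball x r) f" "compact K"
  obtains L where "L-lipschitz_on K f"
proof -
  \<comment> \<open>\<open>local_lipschitz\<close> is about time-dependent functions;
    \<open>f\<close> is viewed as one with the single time 0.\<close>
  have "local_lipschitz {0::real} UNIV (\<lambda>_. f)"
  proof (rule local_lipschitzI)
    fix t :: real and x :: 'a
    obtain r L where "r > 0" "L-lipschitz_on (ball x r) f" using assms(1)[of x] by blast
    moreover have "cball x (r/2) \<inter> UNIV \<subseteq> ball x r"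
      using \<open>r > 0\<close> by auto
    ultimately have "L-lipschitz_on (cball x (r/2) \<inter> UNIV) f"
      by (metis lipschitz_on_subset)
    then have "\<forall>t\<in>cball t (r/2) \<inter> {0}. L-lipschitz_on (cball x (r/2) \<inter> UNIV) f"
      by blast
    moreover have "r / 2 > 0" using \<open>r > 0\<close> by simp
    ultimately show "\<exists>u>0. \<exists>L. \<forall>t\<in>cball t u \<inter> {0}. L-lipschitz_on (cball x u \<inter> UNIV) f"
      by blast
  qed
  then have "local_lipschitz {0::real} K (\<lambda>_. f)"
    by (rule local_lipschitz_subset) auto
  from local_lipschitz_compact_implies_lipschitz[OF this assms(2)]
  show ?thesis using that by auto
qed

text \<open>Averaging \<open>f\<close> over a small ball makes it differentiable along \<open>d\<close>, and the derivative only sees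
  the gradients on a set of full measure.\<close>

lemma gradient_bound_imp_increment_bound:
  fixes f :: "real^'n \<Rightarrow> real"
  assumes lip: "L-lipschitz_on (ball x \<epsilon>) f" and contf: "continuous_on UNIV f"
    and D: "open D" "- D \<in> null_sets lebesgue" "\<And>y. y \<in> D \<Longrightarrow> f differentiable (at y)"
      "continuous_on D (gradient f)"
    and le: "\<And>y. y \<in> D \<Longrightarrow> y \<in> ball x \<epsilon> \<Longrightarrow> gradient f y \<bullet> d \<le> \<alpha>"
    and t: "0 < t" "t * norm d < \<epsilon>"
  shows "f (x + t *\<^sub>R d) - f x \<le> \<alpha> * t"
proof -
  have L: "0 \<le> L" using lip by (rule lipschitz_on_nonneg)
  \<comment> \<open>Replacing \<open>f\<close> by its average over a ball of radius \<open>r\<close>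
    costs at most \<open>L * r\<close> at each end of the segment. One \<open>r\<close> in the
    second condition is for the averaging ball, the other leaves room for difference quotients at
    the ends.\<close>
  have approx: "f (x + t *\<^sub>R d) - f x \<le> \<alpha> * t + 2 * L * r"
    if r: "0 < r" "t * norm d + 2 * r < \<epsilon>" for r
  proof -
    let ?B = "cball 0 r :: (real^'n) set"
    let ?M = "lebesgue_on ?B"
    have meas: "(\<lambda>w. f (a + w)) \<in> borel_measurable ?M" for a
      by (intro continuous_imp_measurable_on_sets_lebesgue continuous_on_compose2[OF contf])
         (auto intro!: continuous_intros)
    have "finite_measure ?M"
      by (intro finite_measure_lebesgue_on) auto
    then interpret M: finite_measure ?M .
    have int_cont: "integrable ?M (\<lambda>w. f (a + w))" for a
    proof -
      have "compact ((\<lambda>w. f (a + w)) ` ?B)"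
        by (intro compact_continuous_image continuous_on_compose2[OF contf])
           (auto intro!: continuous_intros)
      then obtain C where "\<forall>w\<in>?B. norm (f (a + w)) \<le> C"
        using compact_imp_bounded bounded_iff by (metis imageI)
      then show ?thesis
        using meas by (intro M.integrable_const_bound[where B = C] AE_I2) auto
    qed
    have inball: "x + s *\<^sub>R d + w \<in> ball x \<epsilon>"
      if "\<bar>s\<bar> * norm d < t * norm d + r" "w \<in> ?B" for s w
    proof -
      have "norm (s *\<^sub>R d + w) \<le> \<bar>s\<bar> * norm d + norm w"
        by (rule order_trans[OF norm_triangle_ineq]) simp
      also have "\<dots> < \<epsilon>" using that r by simp
      finally have "norm (- (s *\<^sub>R d + w)) < \<epsilon>" by (simp only: norm_minus_cancel)
      then show ?thesis by (simp add: dist_norm algebra_simps)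
    qed
    have inball': "x + s *\<^sub>R d + w \<in> ball x \<epsilon>" if "0 \<le> s" "s \<le> t" "w \<in> ?B" for s w
    proof (rule inball)
      have "\<bar>s\<bar> * norm d \<le> t * norm d"
        using that by (intro mult_right_mono) auto
      then show "\<bar>s\<bar> * norm d < t * norm d + r" using r(1) by simp
    qed fact
    define F where "F s = (\<integral>w. f (x + s *\<^sub>R d + w) \<partial>?M)" for s
    \<comment> \<open>Off \<open>D\<close> the value of \<open>gradient f\<close> is arbitrary;
      cutting it to 0 there gives a Borel function on the whole space.\<close>
    define g where "g z = (if z \<in> D then gradient f z else 0)" for z
    have g: "g \<in> borel_measurable borel"
      unfolding g_def using D by (intro borel_measurable_continuous_on_if) auto
    have g_meas: "(\<lambda>w. g (a + w) \<bullet> d) \<in> borel_measurable ?M" for a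
    proof -
      have "(\<lambda>w. g (a + w) \<bullet> d) \<in> borel_measurable borel"
        using g by measurable
      then show ?thesis
        by (intro measurable_restrict_space1 measurable_completion) simp
    qed
    \<comment> \<open>As \<open>D\<close> is open, its complement is Borel and hence null for
      \<open>lborel\<close> too, where null sets can be translated.\<close>
    have ae: "AE w in ?M. a + w \<in> D" for a
    proof -
      have "- D \<in> null_sets lborel"
        using D(1,2) by (subst null_sets_completion_iff[symmetric]) auto
      then have "{w. w - (- a) \<in> - D} \<in> null_sets lborel"
        by (rule null_sets_translation)
      then have "AE w in lborel. w \<notin> {w. w - (- a) \<in> - D}"
        by (rule AE_not_in)
      then have "AE w in lebesgue. a + w \<in> D"
        by (intro AE_completion) (simp add: add.commute)
      then show ?thesis by (auto simp: AE_restrict_space_iff elim: eventually_mono)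
    qed
    have dq: "\<bar>(f (x + (s + h) *\<^sub>R d + w) - f (x + s *\<^sub>R d + w)) / h\<bar> \<le> L * norm d"
      if "0 \<le> s" "s \<le> t" "w \<in> ?B" "\<bar>h\<bar> * norm d < r" for s h w
    proof -
      have "\<bar>s + h\<bar> * norm d \<le> (\<bar>s\<bar> + \<bar>h\<bar>) * norm d"
        by (intro mult_right_mono abs_triangle_ineq norm_ge_zero)
      moreover have "\<bar>s\<bar> * norm d \<le> t * norm d"
        using that by (intro mult_right_mono) auto
      ultimately have "\<bar>s + h\<bar> * norm d < t * norm d + r"
        using that(4) unfolding distrib_right by linarith
      then have 1: "x + (s + h) *\<^sub>R d + w \<in> ball x \<epsilon>"
        using that(3) by (rule inball)
      have 2: "x + s *\<^sub>R d + w \<in> ball x \<epsilon>"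
        using that(1-3) by (rule inball')
      have "\<bar>f (x + (s + h) *\<^sub>R d + w) - f (x + s *\<^sub>R d + w)\<bar> \<le> L * norm (h *\<^sub>R d)"
        using lipschitz_onD[OF lip 1 2] by (simp add: dist_norm algebra_simps)
      then show ?thesis
        using L by (cases "h = 0") (simp_all add: abs_divide divide_le_eq mult.left_commute mult.commute)
    qed
    \<comment> \<open>Differentiation under the integral sign: the Lipschitz bound \<open>dq\<close>
      is the dominating constant, and pointwise convergence is needed only where the translated
      point lies in \<open>D\<close>.\<close>
    have deriv: "(F has_real_derivative (\<integral>w. g (x + s *\<^sub>R d + w) \<bullet> d \<partial>?M)) (at s)"
      if s: "0 \<le> s" "s \<le> t" for s
      unfolding DERIV_def tendsto_at_iff_sequentially comp_def
    proof (intro allI impI)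
      fix h :: "nat \<Rightarrow> real" assume h0: "\<forall>i. h i \<in> UNIV - {0}" and h: "h \<longlonglongrightarrow> 0"
      have "(\<lambda>i. \<bar>h i\<bar> * norm d) \<longlonglongrightarrow> \<bar>0\<bar> * norm d"
        using h by (intro tendsto_intros)
      then have "\<forall>\<^sub>F i in sequentially. \<bar>h i\<bar> * norm d < r"
        using r(1) by (auto intro: order_tendstoD)
      then obtain N where N: "\<And>i. N \<le> i \<Longrightarrow> \<bar>h i\<bar> * norm d < r"
        by (auto simp: eventually_sequentially)
      let ?q = "\<lambda>i w. (f (x + (s + h i) *\<^sub>R d + w) - f (x + s *\<^sub>R d + w)) / h i"
      \<comment> \<open>The bound \<open>dq\<close> is available only from index \<open>N\<close>
        on, hence the shift, which \<open>LIMSEQ_offset\<close> undoes at the end.\<close>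
      have "(\<lambda>i. \<integral>w. ?q (i + N) w \<partial>?M) \<longlonglongrightarrow> (\<integral>w. g (x + s *\<^sub>R d + w) \<bullet> d \<partial>?M)"
      proof (rule integral_dominated_convergence)
        show "integrable ?M (\<lambda>w. L * norm d)"
          by simp
        show "AE w in ?M. norm (?q (i + N) w) \<le> L * norm d" for i
          using dq[OF s _ N[of "i + N"]] by (intro AE_I2) auto
        show "AE w in ?M. (\<lambda>i. ?q (i + N) w) \<longlonglongrightarrow> g (x + s *\<^sub>R d + w) \<bullet> d"
          using ae[of "x + s *\<^sub>R d"]
        proof eventually_elim
          fix w assume w: "x + s *\<^sub>R d + w \<in> D"
          have "((\<lambda>h. (f (x + s *\<^sub>R d + w + h *\<^sub>R d) - f (x + s *\<^sub>R d + w)) / h)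
              \<longlongrightarrow> gradient f (x + s *\<^sub>R d + w) \<bullet> d) (at 0)"
            using DERIV_along_line[OF D(3)[OF w], of d] by (simp add: DERIV_def)
          then have "(\<lambda>i. ?q i w) \<longlonglongrightarrow> g (x + s *\<^sub>R d + w) \<bullet> d"
            using h0 h w unfolding tendsto_at_iff_sequentially comp_def
            by (auto simp: g_def algebra_simps)
          then show "(\<lambda>i. ?q (i + N) w) \<longlonglongrightarrow> g (x + s *\<^sub>R d + w) \<bullet> d"
            by (rule LIMSEQ_ignore_initial_segment)
        qed
      qed (auto intro!: borel_measurable_divide borel_measurable_diff meas g_meas)
      moreover have "(\<integral>w. ?q i w \<partial>?M) = (F (s + h i) - F s) / h i" for i
        unfolding F_def by (simp add: int_cont)
      ultimately have "(\<lambda>i. (F (s + h (i + N)) - F s) / h (i + N))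
          \<longlonglongrightarrow> (\<integral>w. g (x + s *\<^sub>R d + w) \<bullet> d \<partial>?M)"
        by (simp only:)
      then show "(\<lambda>i. (F (s + h i) - F s) / h i) \<longlonglongrightarrow> (\<integral>w. g (x + s *\<^sub>R d + w) \<bullet> d \<partial>?M)"
        by (rule LIMSEQ_offset)
    qed
    \<comment> \<open>Nothing is known about the intermediate \<open>s\<close>, but for every
      \<open>s\<close> almost all the points \<open>x + s *\<^sub>R d + w\<close> lie in
      \<open>D\<close>.\<close>
    have "\<exists>s>0. s < t \<and> F t - F 0 = (t - 0) * (\<integral>w. g (x + s *\<^sub>R d + w) \<bullet> d \<partial>?M)"
      by (rule MVT2[OF t(1) deriv])
    then obtain s where s: "0 < s" "s < t"
      and Fs: "F t - F 0 = t * (\<integral>w. g (x + s *\<^sub>R d + w) \<bullet> d \<partial>?M)"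
      by (metis diff_zero)
    define V where "V = measure ?M (space ?M)"
    have V: "V > 0"
      using content_cball_pos[OF r(1), of "0::real^'n"]
      by (simp add: V_def measure_restrict_space)
    have bint: "integrable ?M (\<lambda>w. g (x + s *\<^sub>R d + w) \<bullet> d)"
    proof (rule M.integrable_const_bound[where B = "L * norm d"])
      show "AE w in ?M. norm (g (x + s *\<^sub>R d + w) \<bullet> d) \<le> L * norm d"
      proof (rule AE_I2)
        fix w assume "w \<in> space ?M"
        then have b: "x + s *\<^sub>R d + w \<in> ball x \<epsilon>"
          using s r(1) by (intro inball') auto
        have "norm (g (x + s *\<^sub>R d + w)) \<le> L"
          using norm_gradient_le[OF lip open_ball b D(3)] L by (auto simp: g_def)
        then show "norm (g (x + s *\<^sub>R d + w) \<bullet> d) \<le> L * norm d"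
          by (metis Cauchy_Schwarz_ineq2 mult_right_mono norm_ge_zero order_trans real_norm_def)
      qed
    qed (rule g_meas)
    have "(\<integral>w. g (x + s *\<^sub>R d + w) \<bullet> d \<partial>?M) \<le> (\<integral>w. \<alpha> \<partial>?M)"
    proof (rule integral_mono_AE[OF bint])
      show "AE w in ?M. g (x + s *\<^sub>R d + w) \<bullet> d \<le> \<alpha>"
        using ae[of "x + s *\<^sub>R d"] AE_space
      proof eventually_elim
        fix w assume w: "x + s *\<^sub>R d + w \<in> D" "w \<in> space ?M"
        then have "x + s *\<^sub>R d + w \<in> ball x \<epsilon>"
          using s r(1) by (intro inball') auto
        then show "g (x + s *\<^sub>R d + w) \<bullet> d \<le> \<alpha>"
          using w le by (simp add: g_def)
      qed
    qed simp
    then have "F t - F 0 \<le> t * (V * \<alpha>)"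
      using t(1) unfolding Fs by (intro mult_left_mono) (auto simp: V_def)
    moreover have "V * (f (x + t *\<^sub>R d) - f x - 2 * L * r) \<le> F t - F 0"
    proof -
      have "(\<integral>w. f (x + t *\<^sub>R d) - f x - 2 * L * r \<partial>?M)
          \<le> (\<integral>w. f (x + t *\<^sub>R d + w) - f (x + w) \<partial>?M)"
      proof (rule integral_mono)
        fix w assume "w \<in> space ?M"
        then have w: "w \<in> ?B" by simp
        have *: "\<bar>f (x + s *\<^sub>R d + w) - f (x + s *\<^sub>R d)\<bar> \<le> L * r" if "s = 0 \<or> s = t" for s
        proof -
          have 1: "x + s *\<^sub>R d + v \<in> ball x \<epsilon>" if "v \<in> ?B" for v
            using \<open>s = 0 \<or> s = t\<close> t r(1) that by (intro inball') auto
          have "\<bar>f (x + s *\<^sub>R d + w) - f (x + s *\<^sub>R d + 0)\<bar> \<le> L * norm w"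
            using lipschitz_onD[OF lip 1[OF w] 1[of 0]] r(1) by (simp add: dist_norm)
          also have "\<dots> \<le> L * r" using w L by (intro mult_left_mono) auto
          finally show ?thesis by simp
        qed
        show "f (x + t *\<^sub>R d) - f x - 2 * L * r \<le> f (x + t *\<^sub>R d + w) - f (x + w)"
          using *[of 0] *[of t] by simp
      qed (auto intro: int_cont)
      then show ?thesis
        using int_cont[of x] int_cont[of "x + t *\<^sub>R d"] by (simp add: F_def V_def)
    qed
    ultimately have "V * (f (x + t *\<^sub>R d) - f x - 2 * L * r) \<le> V * (\<alpha> * t)"
      by (simp add: mult_ac)
    then show ?thesis
      using V by simp
  qed
  show ?thesis
  proof (rule field_le_epsilon)
    fix e :: real assume "e > 0"
    \<comment> \<open>The first term keeps all translated points inside the ball of radius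
      \<epsilon>, the second makes \<open>2 * L * r\<close> at most \<open>e\<close>;
      \<open>L + 1\<close> avoids a division by zero.\<close>
    define r where "r = min ((\<epsilon> - t * norm d) / 4) (e / (2 * (L + 1)))"
    have r0: "r > 0" using t \<open>e > 0\<close> L by (simp add: r_def)
    have "r \<le> (\<epsilon> - t * norm d) / 4" unfolding r_def by (rule min.cobounded1)
    with r0 have "t * norm d + 2 * r < \<epsilon>" by simp
    moreover have "r \<le> e / (2 * (L + 1))" unfolding r_def by (rule min.cobounded2)
    with L have "r * (2 * (L + 1)) \<le> e" by (simp add: pos_le_divide_eq)
    with r0 have "2 * L * r \<le> e" by (simp add: algebra_simps)
    ultimately show "f (x + t *\<^sub>R d) - f x \<le> \<alpha> * t + e"
      using approx[OF r0] by simp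
  qed
qed

subsection \<open>Minimum norm elements of sampled hulls and boxes\<close>

text \<open>\<open>arg_min_on\<close> is a choice operator, so its value is meaningful only once a
  minimiser exists; compactness supplies one.\<close>

lemma arg_min_on_norm:
  fixes K :: "'a::real_normed_vector set"
  assumes "compact K" "K \<noteq> {}"
  shows "arg_min_on norm K \<in> K" and "k \<in> K \<Longrightarrow> norm (arg_min_on norm K) \<le> norm k"
proof -
  obtain g where g: "g \<in> K" "\<And>k. k \<in> K \<Longrightarrow> norm g \<le> norm k"
    using continuous_attains_inf[OF assms, of norm] by (auto intro: continuous_intros)
  have "is_arg_min norm (\<lambda>x. x \<in> K) (arg_min_on norm K)"
    unfolding arg_min_on_def arg_min_def
    by (rule someI[of _ g]) (use g in \<open>auto simp: is_arg_min_def not_less\<close>)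
  then show "arg_min_on norm K \<in> K" and "k \<in> K \<Longrightarrow> norm (arg_min_on norm K) \<le> norm k"
    by (auto simp: is_arg_min_def not_less)
qed

text \<open>\<open>g\<close> is the projection of 0 onto \<open>K\<close>, and this is the obtuse
  angle criterion: \<open>K\<close> lies beyond the hyperplane through \<open>g\<close> orthogonal
  to \<open>g\<close>.\<close>

lemma min_norm_inner_ge:
  fixes K :: "'a::euclidean_space set"
  assumes "convex K" "closed K" "g \<in> K" "k \<in> K" "\<And>k. k \<in> K \<Longrightarrow> norm g \<le> norm k"
  shows "g \<bullet> g \<le> k \<bullet> g"
  using any_closest_point_dot[OF assms(1-4), of 0] assms(5)
  by (simp add: inner_diff_right inner_commute)

text \<open>Let \<open>p\<close> be the minimum norm point of the closed convex hull of \<Gamma>.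
  Finitely many elements of \<Gamma> have a convex combination close to \<open>p\<close>. A sample
  close to all of them has a hull whose minimum norm element is hardly longer than \<open>p\<close>,
  hence close to \<open>p\<close>, and inherits the projection inequality of \<open>p\<close> up to
  a small error. \<open>T\<close> and \<eta> do not depend on the sample \<open>S\<close>.\<close>

lemma min_norm_hull_inner_ge:
  fixes \<Gamma> :: "'a::euclidean_space set"
  assumes bdd: "\<And>v. v \<in> \<Gamma> \<Longrightarrow> norm v \<le> B" and ne: "\<Gamma> \<noteq> {}"
    and \<nu>: "\<nu> > 0" and c: "c < 1"
  obtains T \<eta> where "finite T" "card T \<le> DIM('a) + 1" "T \<subseteq> \<Gamma>" "0 < \<eta>"
    "\<And>S v. finite S \<Longrightarrow> S \<subseteq> \<Gamma> \<Longrightarrow> (\<And>q. q \<in> T \<Longrightarrow> \<exists>s\<in>S. dist s q < \<eta>) \<Longrightarrow>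
       \<nu> < norm (arg_min_on norm (convex hull S)) \<Longrightarrow> v \<in> \<Gamma> \<Longrightarrow>
       c * (norm (arg_min_on norm (convex hull S)))\<^sup>2 \<le> v \<bullet> arg_min_on norm (convex hull S)"
proof -
  have B: "0 \<le> B" using ne bdd norm_ge_zero order_trans by blast
  define C where "C = closure (convex hull \<Gamma>)"
  have C: "convex C" "closed C" "C \<noteq> {}" "\<Gamma> \<subseteq> C"
    using ne closure_subset hull_subset[of \<Gamma> convex] by (auto simp: C_def)
  define p where "p = closest_point C 0"
  have p: "p \<in> C" "\<And>k. k \<in> C \<Longrightarrow> norm p \<le> norm k"
    using closest_point_exists[OF C(2,3), of 0] by (auto simp: p_def)
  have p_inner: "p \<bullet> p \<le> k \<bullet> p" if "k \<in> C" for k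
    using min_norm_inner_ge[OF C(1,2) p(1) that p(2)] .
  have pB: "norm p \<le> B"
    using ne bdd p(2) C(4) by (metis ex_in_conv order_trans subsetD)
  \<comment> \<open>\<kappa> will bound \<open>norm (g - p)\<close>. The final error is \<kappa>^2 +
    B * \<kappa>, at most \<kappa> * (B + 1) since \<kappa> \<le> 1, and this must not exceed (1 -
    c) * \<nu>^2.\<close>
  define \<kappa> where "\<kappa> = min 1 ((1 - c) * \<nu>\<^sup>2 / (B + 1))"
  have \<kappa>: "0 < \<kappa>" "\<kappa> \<le> 1" using \<nu> c B by (auto simp: \<kappa>_def)
  have "\<kappa> \<le> (1 - c) * \<nu>\<^sup>2 / (B + 1)" unfolding \<kappa>_def by (rule min.cobounded2)
  then have \<kappa>': "\<kappa> * (B + 1) \<le> (1 - c) * \<nu>\<^sup>2" using B by (simp add: pos_le_divide_eq)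
  \<comment> \<open>Chosen so that squaring \<open>norm p + 2 * \<delta>\<close> adds at most
    \<kappa>^2 to the square of \<open>norm p\<close>.\<close>
  define \<delta> where "\<delta> = \<kappa>\<^sup>2 / (4 * (B + 1))"
  have \<delta>: "0 < \<delta>" using \<kappa> B by (simp add: \<delta>_def)
  have \<delta>_eq: "4 * \<delta> * (B + 1) = \<kappa>\<^sup>2" using B by (simp add: \<delta>_def field_simps)
  have "4 * \<delta> \<le> 4 * \<delta> * (B + 1)" using \<delta> B by simp
  also have "\<dots> \<le> 1" unfolding \<delta>_eq using \<kappa> by (simp add: power_le_one)
  finally have \<delta>1: "\<delta> \<le> 1" by simp
  obtain p' where p': "p' \<in> convex hull \<Gamma>" "dist p' p < \<delta>"
    using p(1) \<delta> unfolding C_def closure_approachable by blast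
  obtain T w where T: "finite T" "T \<subseteq> \<Gamma>" "card T \<le> DIM('a) + 1"
    and w: "\<And>q. q \<in> T \<Longrightarrow> 0 \<le> w q" "sum w T = 1" "(\<Sum>q\<in>T. w q *\<^sub>R q) = p'"
    using p'(1) unfolding convex_hull_caratheodory by blast
  show ?thesis
  proof (rule that[OF T(1,3,2) \<delta>])
    fix S v assume S: "finite S" "S \<subseteq> \<Gamma>" and near: "\<And>q. q \<in> T \<Longrightarrow> \<exists>s\<in>S. dist s q < \<delta>"
    let ?K = "convex hull S"
    define g where "g = arg_min_on norm ?K"
    assume "\<nu> < norm (arg_min_on norm ?K)" and v: "v \<in> \<Gamma>"
    then have g\<nu>: "\<nu> < norm g" by (simp add: g_def)
    have "T \<noteq> {}" using w(2) by auto
    then have "S \<noteq> {}" using near by blast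
    then have K: "compact ?K" "?K \<noteq> {}"
      using S(1) by (auto intro: finite_imp_compact_convex_hull)
    have gK: "g \<in> ?K" unfolding g_def by (rule arg_min_on_norm(1)[OF K])
    have gC: "g \<in> C"
      using gK hull_mono[OF S(2), of convex] closure_subset unfolding C_def by blast
    obtain s where s: "\<And>q. q \<in> T \<Longrightarrow> s q \<in> S" "\<And>q. q \<in> T \<Longrightarrow> dist (s q) q < \<delta>"
      using near by metis
    \<comment> \<open>The Caratheodory weights of \<open>p'\<close> are kept and moved to nearby
      sampled points, which shifts the combination by at most \<delta>.\<close>
    let ?p = "\<Sum>q\<in>T. w q *\<^sub>R s q"
    have pK: "?p \<in> ?K"
      using T(1) w s(1) by (intro convex_sum) (auto intro: hull_inc)
    have "norm (?p - p') = norm (\<Sum>q\<in>T. w q *\<^sub>R (s q - q))"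
      using w(3) by (simp add: scaleR_diff_right sum_subtractf)
    also have "\<dots> \<le> (\<Sum>q\<in>T. w q * \<delta>)"
      by (rule sum_norm_le) (use w(1) s(2) in \<open>auto simp: dist_norm less_imp_le intro!: mult_left_mono\<close>)
    also have "\<dots> = \<delta>" using w(2) by (simp flip: sum_distrib_right)
    finally have "norm ?p \<le> norm p' + \<delta>"
      using norm_triangle_ineq2[of ?p p'] by linarith
    moreover have "norm p' \<le> norm p + \<delta>"
      using p'(2) norm_triangle_ineq2[of p' p] by (simp add: dist_norm)
    moreover have "norm g \<le> norm ?p"
      unfolding g_def using arg_min_on_norm(2)[OF K pK] .
    ultimately have gp: "norm g \<le> norm p + 2 * \<delta>" by linarith
    have "(norm g)\<^sup>2 \<le> (norm p + 2 * \<delta>)\<^sup>2"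
      using gp by (intro power_mono) auto
    also have "\<dots> = (norm p)\<^sup>2 + 4 * \<delta> * (norm p + \<delta>)"
      by (simp add: power2_eq_square algebra_simps)
    also have "\<dots> \<le> (norm p)\<^sup>2 + 4 * \<delta> * (B + 1)"
      using \<delta> \<delta>1 pB by (intro add_left_mono mult_left_mono) auto
    finally have sq: "(norm g)\<^sup>2 \<le> (norm p)\<^sup>2 + \<kappa>\<^sup>2" unfolding \<delta>_eq .
    \<comment> \<open>Nearly equal norms force nearness here: the projection inequality for
      \<open>p\<close> turns the right-hand side into at most the difference of the squared
      norms.\<close>
    have "(norm (g - p))\<^sup>2 = (norm g)\<^sup>2 - 2 * (g \<bullet> p) + (norm p)\<^sup>2"
      by (simp add: power2_norm_eq_inner inner_diff inner_commute)
    also have "\<dots> \<le> \<kappa>\<^sup>2"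
      using p_inner[OF gC] sq by (simp add: power2_norm_eq_inner)
    finally have gp\<kappa>: "norm (g - p) \<le> \<kappa>"
      using \<kappa>(1) power2_le_imp_le by (metis less_imp_le)
    have "\<bar>v \<bullet> (g - p)\<bar> \<le> norm v * norm (g - p)"
      by (rule Cauchy_Schwarz_ineq2)
    also have "\<dots> \<le> B * \<kappa>"
      using bdd[OF v] gp\<kappa> B by (intro mult_mono) auto
    finally have "v \<bullet> g \<ge> v \<bullet> p - B * \<kappa>"
      by (simp add: inner_diff_right)
    moreover have "v \<bullet> p \<ge> (norm p)\<^sup>2"
      using p_inner v C(4) by (auto simp: power2_norm_eq_inner)
    moreover have "\<kappa>\<^sup>2 \<le> \<kappa>"
      using \<kappa> by (simp add: power2_eq_square mult_left_le)
    moreover have "(1 - c) * \<nu>\<^sup>2 \<le> (1 - c) * (norm g)\<^sup>2"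
      using g\<nu> \<nu> c by (intro mult_left_mono power_mono) auto
    ultimately have "c * (norm g)\<^sup>2 \<le> v \<bullet> g"
      using sq \<kappa>' by (simp add: algebra_simps)
    then show "c * (norm (arg_min_on norm ?K))\<^sup>2 \<le> v \<bullet> arg_min_on norm ?K"
      by (simp add: g_def)
  qed
qed

text \<open>The coordinates decouple into projections of 0 onto intervals. An interval is determined
  by its two ends, so for each coordinate one element of \<Gamma> with nearly least and one with
  nearly greatest component suffice.\<close>

lemma min_norm_box_inner_ge:
  fixes \<Gamma> :: "(real^'n) set"
  assumes bdd: "\<And>v. v \<in> \<Gamma> \<Longrightarrow> norm v \<le> B" and ne: "\<Gamma> \<noteq> {}"
    and \<nu>: "\<nu> > 0" and c: "c < 1"
  obtains T \<eta> where "finite T" "card T \<le> 2 * CARD('n)" "T \<subseteq> \<Gamma>" "0 < \<eta>"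
    "\<And>S v g. finite S \<Longrightarrow> S \<subseteq> \<Gamma> \<Longrightarrow> (\<And>q. q \<in> T \<Longrightarrow> \<exists>s\<in>S. dist s q < \<eta>) \<Longrightarrow>
       g = (\<chi> i. arg_min_on abs (convex hull ((\<lambda>s. s $ i) ` S))) \<Longrightarrow> \<nu> < norm g \<Longrightarrow> v \<in> \<Gamma> \<Longrightarrow>
       c * (norm g)\<^sup>2 \<le> v \<bullet> g"
proof -
  define n where "n = real CARD('n)"
  have n: "n > 0" by (simp add: n_def)
  \<comment> \<open>Summed over the coordinates the loss is at most
    \<open>2 * \<eta> * n * norm g\<close>, which this choice makes equal to
    \<open>(1 - c) * \<nu> * norm g\<close>.\<close>
  define \<eta> where "\<eta> = (1 - c) * \<nu> / (2 * n)"
  have \<eta>: "0 < \<eta>" using \<nu> c n by (simp add: \<eta>_def)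
  have comp: "\<bar>v $ i\<bar> \<le> B" if "v \<in> \<Gamma>" for v i
    using bdd[OF that] component_le_norm_cart[of v i] by linarith
  have bddb: "bdd_below ((\<lambda>v. v $ i) ` \<Gamma>)" and bdda: "bdd_above ((\<lambda>v. v $ i) ` \<Gamma>)" for i
    using comp by (auto intro!: bdd_belowI[of _ "-B"] bdd_aboveI[of _ B] simp: abs_le_iff minus_le_iff)
  have "\<exists>q\<in>\<Gamma>. \<forall>v\<in>\<Gamma>. q $ i < v $ i + \<eta>" for i
  proof -
    obtain q where "q \<in> \<Gamma>" "q $ i < (INF v\<in>\<Gamma>. v $ i) + \<eta>"
      using cInf_lessD[of "(\<lambda>v. v $ i) ` \<Gamma>" "(INF v\<in>\<Gamma>. v $ i) + \<eta>"] ne \<eta> by auto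
    then show ?thesis
      using cINF_lower[OF bddb[of i]] by (smt (verit))
  qed
  then obtain lo where lo: "\<And>i. lo i \<in> \<Gamma>" "\<And>i v. v \<in> \<Gamma> \<Longrightarrow> lo i $ i < v $ i + \<eta>"
    by metis
  have "\<exists>q\<in>\<Gamma>. \<forall>v\<in>\<Gamma>. v $ i - \<eta> < q $ i" for i
  proof -
    obtain q where "q \<in> \<Gamma>" "(SUP v\<in>\<Gamma>. v $ i) - \<eta> < q $ i"
      using less_cSupD[of "(\<lambda>v. v $ i) ` \<Gamma>" "(SUP v\<in>\<Gamma>. v $ i) - \<eta>"] ne \<eta> by auto
    then show ?thesis
      using cSUP_upper[OF _ bdda[of i]] by (smt (verit))
  qed
  then obtain hi where hi: "\<And>i. hi i \<in> \<Gamma>" "\<And>i v. v \<in> \<Gamma> \<Longrightarrow> v $ i - \<eta> < hi i $ i"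
    by metis
  show ?thesis
  proof (rule that[of "range lo \<union> range hi" \<eta>])
    have "card (range lo \<union> range hi) \<le> card (range lo) + card (range hi)"
      by (rule card_Un_le)
    also have "\<dots> \<le> CARD('n) + CARD('n)"
      by (intro add_mono card_image_le) auto
    finally show "card (range lo \<union> range hi) \<le> 2 * CARD('n)" by simp
    fix S v g assume S: "finite S" "S \<subseteq> \<Gamma>"
      and near: "\<And>q. q \<in> range lo \<union> range hi \<Longrightarrow> \<exists>s\<in>S. dist s q < \<eta>"
      and g: "g = (\<chi> i. arg_min_on abs (convex hull ((\<lambda>s. s $ i) ` S)))"
      and g\<nu>: "\<nu> < norm g" and v: "v \<in> \<Gamma>"
    have "S \<noteq> {}" using near by blast
    have g_inner: "(g $ i)\<^sup>2 \<le> s $ i * g $ i" if "s \<in> S" for i s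
    proof -
      let ?K = "convex hull ((\<lambda>s. s $ i) ` S)"
      have K: "compact ?K" "?K \<noteq> {}"
        using S(1) \<open>S \<noteq> {}\<close> by (auto intro: finite_imp_compact_convex_hull)
      have "g $ i = arg_min_on norm ?K"
        by (simp add: g real_norm_def[abs_def])
      then show ?thesis
        using min_norm_inner_ge[OF convex_convex_hull compact_imp_closed[OF K(1)]
            arg_min_on_norm(1)[OF K] _ arg_min_on_norm(2)[OF K], of "s $ i"] that
        by (auto simp: power2_eq_square hull_inc)
    qed
    \<comment> \<open>One \<eta> is lost because \<open>lo\<close> and \<open>hi\<close> are only
      nearly extreme, another because the sample only comes close to them. The sign of
      \<open>g $ i\<close> decides which end matters.\<close>
    have "(g $ i)\<^sup>2 - 2 * \<eta> * \<bar>g $ i\<bar> \<le> v $ i * g $ i" for i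
    proof -
      obtain s where s: "s \<in> S" "dist s (lo i) < \<eta>" using near by blast
      obtain s' where s': "s' \<in> S" "dist s' (hi i) < \<eta>" using near by blast
      have 1: "s $ i \<le> v $ i + 2 * \<eta>"
        using lo(2)[OF v, of i] s(2) component_le_norm_cart[of "s - lo i" i] by (simp add: dist_norm)
      have 2: "v $ i - 2 * \<eta> \<le> s' $ i"
        using hi(2)[OF v, of i] s'(2) component_le_norm_cart[of "s' - hi i" i] by (simp add: dist_norm)
      show ?thesis
      proof (cases "g $ i \<ge> 0")
        case True
        then show ?thesis
          using mult_right_mono[OF 1 True] g_inner[OF s(1), of i] by (simp add: algebra_simps)
      next
        case False
        then show ?thesis
          using mult_right_mono_neg[OF 2, of "g $ i"] g_inner[OF s'(1), of i] by (simp add: algebra_simps)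
      qed
    qed
    then have "(\<Sum>i\<in>UNIV. (g $ i)\<^sup>2 - 2 * \<eta> * \<bar>g $ i\<bar>) \<le> (\<Sum>i\<in>UNIV. v $ i * g $ i)"
      by (rule sum_mono)
    then have "(norm g)\<^sup>2 - 2 * \<eta> * (\<Sum>i\<in>UNIV. \<bar>g $ i\<bar>) \<le> v \<bullet> g"
      by (simp add: sum_subtractf sum_distrib_left power2_norm_eq_inner inner_vec_def
          flip: power2_eq_square)
    moreover have "2 * \<eta> * (\<Sum>i\<in>UNIV. \<bar>g $ i\<bar>) \<le> 2 * \<eta> * (n * norm g)"
    proof (intro mult_left_mono)
      show "(\<Sum>i\<in>UNIV. \<bar>g $ i\<bar>) \<le> n * norm g"
        unfolding n_def by (rule sum_bounded_above) (rule component_le_norm_cart)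
    qed (use \<eta> in simp)
    moreover have "2 * \<eta> * (n * norm g) = (1 - c) * \<nu> * norm g"
      using n by (simp add: \<eta>_def)
    moreover have "(1 - c) * \<nu> * norm g \<le> (1 - c) * (norm g)\<^sup>2"
      using c g\<nu> by (simp add: power2_eq_square mult_right_mono mult_left_mono)
    ultimately show "c * (norm g)\<^sup>2 \<le> v \<bullet> g"
      by (simp add: algebra_simps)
  qed (use lo hi \<eta> in auto)
qed

subsection \<open>Line search and open sets of accepted samples\<close>

text \<open>The guard bounds the number of passes: \<open>\<gamma> ^ N * t \<le> tmin\<close> means
  that at most \<open>N\<close> of them are left, and the induction runs over this
  \<open>N\<close>.\<close>

lemma lbals_loop_zero_or_decrease:
  assumes "0 < tmin" "0 < \<gamma>" "\<gamma> < 1"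
  shows "lbals_loop f x g d tmin \<gamma> c t = 0 \<or>
    tmin < lbals_loop f x g d tmin \<gamma> c t \<and>
    f (x + lbals_loop f x g d tmin \<gamma> c t *\<^sub>R d) - f x
      < - (c * lbals_loop f x g d tmin \<gamma> c t * norm g)"
proof -
  obtain N where "\<gamma> ^ N < tmin / (\<bar>t\<bar> + 1)"
    using real_arch_pow_inv[of "tmin / (\<bar>t\<bar> + 1)" \<gamma>] assms by auto
  then have "\<gamma> ^ N * (\<bar>t\<bar> + 1) \<le> tmin"
    by (simp add: pos_less_divide_eq less_imp_le)
  moreover have "\<gamma> ^ N * t \<le> \<gamma> ^ N * (\<bar>t\<bar> + 1)"
    using assms by (intro mult_left_mono) auto
  ultimately have "\<gamma> ^ N * t \<le> tmin" by linarith
  then show ?thesis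
  proof (induction N arbitrary: t)
    case 0
    then show ?case by (subst (1 2 3 4) lbals_loop.simps) auto
  next
    case (Suc N)
    then have "\<gamma> ^ N * (\<gamma> * t) \<le> tmin" by (simp add: mult_ac)
    from Suc.IH[OF this] show ?case
      by (subst (1 2 3 4) lbals_loop.simps) auto
  qed
qed

lemma lbals_zero_or_decrease:
  assumes "0 < \<epsilon>" "0 < \<gamma>" "\<gamma> < 1"
  shows "lbals f x g d \<epsilon> \<gamma> c = 0 \<or>
    min 1 (\<gamma> * \<epsilon> / 3) < lbals f x g d \<epsilon> \<gamma> c \<and>
    f (x + lbals f x g d \<epsilon> \<gamma> c *\<^sub>R d) - f x < - (c * lbals f x g d \<epsilon> \<gamma> c * norm g)"
  unfolding lbals_def by (rule lbals_loop_zero_or_decrease) (use assms in auto)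

text \<open>The loop may already accept a longer step than \<open>\<gamma> ^ p * t\<close>, but it
  cannot pass this one.\<close>

lemma lbals_loop_nonzero:
  assumes "0 < tmin" "0 < \<gamma>" "\<gamma> < 1" "tmin < \<gamma> ^ p * t"
    and "f (x + (\<gamma> ^ p * t) *\<^sub>R d) - f x < - (c * (\<gamma> ^ p * t) * norm g)"
  shows "lbals_loop f x g d tmin \<gamma> c t \<noteq> 0"
  using assms(4,5)
proof (induction p arbitrary: t)
  case 0
  then show ?case using assms(1) by (subst lbals_loop.simps) auto
next
  case (Suc p)
  then have "0 < t"
    using assms(1,2) by (smt (verit) zero_less_mult_iff zero_less_power)
  then have "\<gamma> ^ Suc p * t \<le> 1 * t"
    using assms(2,3) by (intro mult_right_mono power_le_one) auto
  then have "tmin < t" using Suc.prems by simp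
  moreover have "lbals_loop f x g d tmin \<gamma> c (\<gamma> * t) \<noteq> 0"
    using Suc.prems by (intro Suc.IH) (simp_all add: mult_ac)
  ultimately show ?case using assms(1) by (subst lbals_loop.simps) auto
qed

text \<open>The first power not exceeding \<open>a\<close> works, since its predecessor is larger
  than \<open>a\<close>; if it is the power 0, \<open>\<gamma> * a < 1\<close> applies. With
  \<open>a = \<epsilon> / 3\<close> this yields a trial step above the cut-off of the line
  search.\<close>

lemma power_in_scale:
  fixes \<gamma> a :: real
  assumes "0 < \<gamma>" "\<gamma> < 1" "0 < a" "\<gamma> * a < 1"
  obtains p where "\<gamma> * a < \<gamma> ^ p" "\<gamma> ^ p \<le> a"
proof -
  have ex: "\<exists>p. \<gamma> ^ p \<le> a"
    using real_arch_pow_inv[OF assms(3,2)] less_imp_le by blast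
  define p where "p = (LEAST p. \<gamma> ^ p \<le> a)"
  have p: "\<gamma> ^ p \<le> a" unfolding p_def by (rule LeastI_ex[OF ex])
  have "\<gamma> * a < \<gamma> ^ p"
  proof (cases p)
    case 0
    then show ?thesis using assms by simp
  next
    case (Suc k)
    then have "\<not> \<gamma> ^ k \<le> a"
      unfolding p_def by (metis lessI not_less_Least)
    then show ?thesis using assms Suc by simp
  qed
  with p that show ?thesis by blast
qed

lemma lbals_nonzero:
  assumes "0 < \<epsilon>" "0 < \<gamma>" "\<gamma> < 1" "\<gamma> * \<epsilon> < 3"
    and "\<And>t. 0 < t \<Longrightarrow> t \<le> \<epsilon> / 3 \<Longrightarrow> f (x + t *\<^sub>R d) - f x < - (c * t * norm g)"
  shows "lbals f x g d \<epsilon> \<gamma> c \<noteq> 0"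
proof -
  obtain p where p: "\<gamma> * (\<epsilon> / 3) < \<gamma> ^ p" "\<gamma> ^ p \<le> \<epsilon> / 3"
    using power_in_scale[of \<gamma> "\<epsilon> / 3"] assms by auto
  show ?thesis
    unfolding lbals_def
    by (rule lbals_loop_nonzero[where p = p]) (use p assms(1-4) assms(5)[of "\<gamma> ^ p"] in auto)
qed

text \<open>Assigns to each sample index a target point at which a required gradient occurs; surplus
  indices receive an arbitrary point of \<open>P\<close>.\<close>

lemma enumerate_preimages:
  assumes "finite T" "card T \<le> m" "T \<subseteq> h ` P" "P \<noteq> {}"
  obtains q where "\<And>j. q j \<in> P" "T \<subseteq> (\<lambda>j. h (q j)) ` {1..m}"
proof -
  obtain b where b: "bij_betw b {1..card T} T"
    using ex_bij_betw_nat_finite_1[OF assms(1)] by blast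
  have "\<forall>y\<in>T. \<exists>z. z \<in> P \<and> h z = y" using assms(3) by blast
  from bchoice[OF this] obtain e where e: "\<And>y. y \<in> T \<Longrightarrow> e y \<in> P \<and> h (e y) = y"
    by blast
  obtain x where x: "x \<in> P" using assms(4) by blast
  define q where "q j = (if j \<in> {1..card T} then e (b j) else x)" for j
  have bT: "b j \<in> T" if "j \<in> {1..card T}" for j using b that by (auto simp: bij_betw_def)
  show ?thesis
  proof
    show "q j \<in> P" for j using e bT x by (auto simp: q_def)
    show "T \<subseteq> (\<lambda>j. h (q j)) ` {1..m}"
    proof
      fix y assume "y \<in> T"
      then have "y \<in> b ` {1..card T}" using b by (simp add: bij_betw_def)
      then obtain j where j: "j \<in> {1..card T}" "y = b j" by blast
      then have "y = h (q j)" using e[OF bT[OF j(1)]] by (simp add: q_def)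
      moreover have "j \<in> {1..m}" using j(1) assms(2) by auto
      ultimately show "y \<in> (\<lambda>j. h (q j)) ` {1..m}" by blast
    qed
  qed
qed

locale locally_lipschitz_almost_C1 =
  fixes f :: "real^'n \<Rightarrow> real" and D :: "(real^'n) set"
  assumes locally_lipschitz: "\<And>x. \<exists>r>0. \<exists>L. L-lipschitz_on (ball x r) f"
    and open_D: "open D"
    and full_measure: "- D \<in> null_sets lebesgue"
    and differentiable_D: "\<And>x. x \<in> D \<Longrightarrow> f differentiable (at x)"
    and continuous_gradient: "continuous_on D (gradient f)"
begin

lemma continuous_on_f: "continuous_on UNIV f"
proof -
  have "isCont f x" for x
  proof -
    obtain r L where "r > 0" "L-lipschitz_on (ball x r) f" using locally_lipschitz[of x] by blast
    then show ?thesis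
      by (metis centre_in_ball continuous_on_interior interior_open lipschitz_on_continuous_on open_ball)
  qed
  then show ?thesis by (simp add: continuous_at_imp_continuous_on)
qed

lemma D_meets_open:
  assumes "open U" "U \<noteq> {}"
  shows "D \<inter> U \<noteq> {}"
proof
  assume "D \<inter> U = {}"
  then have "U \<subseteq> - D" by blast
  then have "negligible U"
    using full_measure negligible_subset unfolding negligible_iff_null_sets[symmetric] by blast
  then show False using open_not_negligible[OF assms] by blast
qed

text \<open>The gradient at \<open>x\<close> itself is always sampled, the other gradients needed by the two minimum norm
  lemmas are approximated on open sets of sample directions. There are at most \<open>2n + (n + 1)\<close> of them,
  which is where the sample size \<open>4n\<close> comes from.\<close>

lemma open_samples_accepted:
  assumes x: "f differentiable (at x)"
    and par: "0 < \<nu>" "0 < \<epsilon>" "0 < \<gamma>" "\<gamma> < 1" "0 < c" "c < 1" "\<gamma> * \<epsilon> < 3"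
    and m: "m = 4 * CARD('n)"
  obtains V where "\<And>j. open (V j)" "\<And>j. V j \<noteq> {}" "\<And>j. V j \<subseteq> ball 0 1"
    "\<And>u g. (\<And>j. j \<in> {1..m} \<Longrightarrow> u j \<in> V j) \<Longrightarrow> g = gsi_vector f m (sample_point x \<epsilon> u) \<nu> \<Longrightarrow>
       norm g \<le> \<nu> \<or> lbals f x g (- (inverse (norm g) *\<^sub>R g)) \<epsilon> \<gamma> c \<noteq> 0"
proof -
  obtain L where "L-lipschitz_on (cball x \<epsilon>) f"
    using locally_lipschitz_compact[OF locally_lipschitz compact_cball] by blast
  then have lip: "L-lipschitz_on (ball x \<epsilon>) f"
    by (rule lipschitz_on_subset) auto
  \<comment> \<open>The point \<open>x\<close> is only known to be a point of differentiability and
    may lie outside \<open>D\<close>, so its gradient is added separately.\<close>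
  define P where "P = insert x (D \<inter> ball x \<epsilon>)"
  define \<Gamma> where "\<Gamma> = gradient f ` P"
  have bdd: "norm v \<le> L" if "v \<in> \<Gamma>" for v
    using that x par(2) norm_gradient_le[OF lip open_ball _ differentiable_D]
      norm_gradient_le[OF lip open_ball _ x]
    by (auto simp: \<Gamma>_def P_def)
  have ne: "\<Gamma> \<noteq> {}" "P \<noteq> {}" by (auto simp: \<Gamma>_def P_def)
  \<comment> \<open>A constant strictly above \<open>c\<close> turns the non-strict mean value bound
    into the strict Armijo inequality.\<close>
  define c' where "c' = (1 + c) / 2"
  have c': "c < c'" "c' < 1" using par by (auto simp: c'_def)
  obtain T1 \<eta>1 where T1: "finite T1" "card T1 \<le> DIM(real^'n) + 1" "T1 \<subseteq> \<Gamma>" "0 < \<eta>1"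
    and std: "\<And>S v. finite S \<Longrightarrow> S \<subseteq> \<Gamma> \<Longrightarrow> (\<And>q. q \<in> T1 \<Longrightarrow> \<exists>s\<in>S. dist s q < \<eta>1) \<Longrightarrow>
       \<nu> < norm (arg_min_on norm (convex hull S)) \<Longrightarrow> v \<in> \<Gamma> \<Longrightarrow>
       c' * (norm (arg_min_on norm (convex hull S)))\<^sup>2 \<le> v \<bullet> arg_min_on norm (convex hull S)"
  proof (rule min_norm_hull_inner_ge[OF bdd ne(1) par(1) c'(2)], goal_cases)
    case (2 T \<eta>)
    show ?case by (rule 2(1)[OF 2(2-)])
  qed simp
  obtain T2 \<eta>2 where T2: "finite T2" "card T2 \<le> 2 * CARD('n)" "T2 \<subseteq> \<Gamma>" "0 < \<eta>2"
    and box: "\<And>S v g. finite S \<Longrightarrow> S \<subseteq> \<Gamma> \<Longrightarrow> (\<And>q. q \<in> T2 \<Longrightarrow> \<exists>s\<in>S. dist s q < \<eta>2) \<Longrightarrow>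
       g = (\<chi> i. arg_min_on abs (convex hull ((\<lambda>s. s $ i) ` S))) \<Longrightarrow> \<nu> < norm g \<Longrightarrow> v \<in> \<Gamma> \<Longrightarrow>
       c' * (norm g)\<^sup>2 \<le> v \<bullet> g"
  proof (rule min_norm_box_inner_ge[OF bdd ne(1) par(1) c'(2)], goal_cases)
    case (2 T \<eta>)
    show ?case by (rule 2(1)[OF 2(2-)])
  qed simp
  define \<eta> where "\<eta> = min \<eta>1 \<eta>2"
  have \<eta>: "0 < \<eta>" "\<eta> \<le> \<eta>1" "\<eta> \<le> \<eta>2" using T1 T2 by (auto simp: \<eta>_def)
  have "CARD('n) \<ge> 1" by (simp add: Suc_leI)
  moreover have "card T1 \<le> CARD('n) + 1" using T1(2) by simp
  ultimately have "card (T1 \<union> T2) \<le> m"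
    using card_Un_le[of T1 T2] T2(2) unfolding m by linarith
  then obtain q where q: "\<And>j. q j \<in> P" "T1 \<union> T2 \<subseteq> (\<lambda>j. gradient f (q j)) ` {1..m}"
    using enumerate_preimages[of "T1 \<union> T2" m "gradient f" P] T1(1,3) T2(1,3) ne(2)
    unfolding \<Gamma>_def by (metis Un_least finite_UnI)
  \<comment> \<open>If \<open>q j\<close> is in \<open>D\<close>, continuity of the gradient gives
    an open set of directions with gradients close to the target. Otherwise \<open>q j\<close> is
    \<open>x\<close>, whose gradient is sampled anyway as the one with index 0, and the direction
    only has to lead into \<open>D\<close>.\<close>
  define V where "V j = ball 0 1 \<inter> (\<lambda>w. x + \<epsilon> *\<^sub>R w) -`
      (if q j \<in> D then D \<inter> gradient f -` ball (gradient f (q j)) \<eta> else D)" for j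
  show ?thesis
  proof
    show "open (V j)" for j
    proof -
      have "open (if q j \<in> D then D \<inter> gradient f -` ball (gradient f (q j)) \<eta> else D)"
        using open_D continuous_open_preimage[OF continuous_gradient open_D open_ball] by auto
      then show ?thesis
        unfolding V_def by (intro open_Int open_ball open_vimage) (auto intro!: continuous_intros)
    qed
    show "V j \<noteq> {}" for j
    proof -
      have scale: "w \<in> ball x \<epsilon> \<Longrightarrow> (1 / \<epsilon>) *\<^sub>R (w - x) \<in> ball 0 1 \<and> x + \<epsilon> *\<^sub>R ((1 / \<epsilon>) *\<^sub>R (w - x)) = w" for w
        using par(2) by (simp add: dist_norm norm_minus_commute divide_less_eq)
      obtain w where w: "w \<in> ball x \<epsilon>" "w \<in> D" "q j \<in> D \<Longrightarrow> w = q j"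
      proof (cases "q j \<in> D")
        case True
        then show ?thesis using that[of "q j"] q(1)[of j] par(2) by (auto simp: P_def)
      next
        case False
        then show ?thesis using that D_meets_open[of "ball x \<epsilon>"] par(2) by auto
      qed
      then have "(1 / \<epsilon>) *\<^sub>R (w - x) \<in> V j"
        using scale[OF w(1)] \<eta>(1) unfolding V_def by auto
      then show ?thesis by blast
    qed
    show "V j \<subseteq> ball 0 1" for j by (auto simp: V_def)
    fix u :: "nat \<Rightarrow> real^'n" and g
    assume u: "\<And>j. j \<in> {1..m} \<Longrightarrow> u j \<in> V j"
      and g: "g = gsi_vector f m (sample_point x \<epsilon> u) \<nu>"
    let ?s = "sample_point x \<epsilon> u"
    define S where "S = (\<lambda>j. gradient f (?s j)) ` {0..m}"
    have sD: "?s j \<in> D \<inter> ball x \<epsilon>" if "j \<in> {1..m}" for j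
      using u[OF that] that par(2) by (auto simp: V_def sample_point_def dist_norm split: if_splits)
    have s0: "?s 0 = x" by (simp add: sample_point_def)
    have "?s j \<in> P" if "j \<in> {0..m}" for j
      using sD[of j] that s0 by (cases "j = 0") (auto simp: P_def)
    then have S: "finite S" "S \<subseteq> \<Gamma>" by (auto simp: S_def \<Gamma>_def)
    have near: "\<exists>s\<in>S. dist s v < \<eta>" if "v \<in> T1 \<union> T2" for v
    proof -
      have "v \<in> (\<lambda>j. gradient f (q j)) ` {1..m}" using q(2) that by blast
      then obtain j where j: "j \<in> {1..m}" "v = gradient f (q j)" by blast
      show ?thesis
      proof (cases "q j \<in> D")
        case True
        then have "dist (gradient f (?s j)) v < \<eta>"
          using u[OF j(1)] j by (auto simp: V_def sample_point_def dist_commute)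
        moreover have "gradient f (?s j) \<in> S" using j(1) by (auto simp: S_def)
        ultimately show ?thesis by blast
      next
        case False
        then have "v = gradient f (?s 0)" using q(1)[of j] j s0 by (simp add: P_def)
        then have "v \<in> S" by (simp add: S_def)
        then show ?thesis using \<eta>(1) by (intro bexI[of _ v]) auto
      qed
    qed
    have near1: "\<exists>s\<in>S. dist s v < \<eta>1" if "v \<in> T1" for v
    proof -
      obtain s where "s \<in> S" "dist s v < \<eta>" using near[of v] \<open>v \<in> T1\<close> by blast
      then show ?thesis using \<eta>(2) by (intro bexI[of _ s]) auto
    qed
    have near2: "\<exists>s\<in>S. dist s v < \<eta>2" if "v \<in> T2" for v
    proof -
      obtain s where "s \<in> S" "dist s v < \<eta>" using near[of v] \<open>v \<in> T2\<close> by blast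
      then show ?thesis using \<eta>(3) by (intro bexI[of _ s]) auto
    qed
    show "norm g \<le> \<nu> \<or> lbals f x g (- (inverse (norm g) *\<^sub>R g)) \<epsilon> \<gamma> c \<noteq> 0"
    proof (cases "norm g \<le> \<nu>")
      case False
      then have g\<nu>: "\<nu> < norm g" by simp
      \<comment> \<open>Which of the two vectors \<open>gsi_vector\<close> keeps depends on the
        sample, so the same open sets must serve both minimum norm lemmas.\<close>
      have inner: "c' * (norm g)\<^sup>2 \<le> v \<bullet> g" if "v \<in> \<Gamma>" for v
      proof (cases "norm (g_interval f m ?s) \<le> \<nu>")
        case True
        then have "g = arg_min_on norm (convex hull S)"
          by (simp add: g gsi_vector_def g_std_def gradient_hull_def S_def)
        then show ?thesis using std[OF S near1 _ that] g\<nu> by simp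
      next
        case False
        then have "g = (\<chi> i. arg_min_on abs (convex hull ((\<lambda>s. s $ i) ` S)))"
          by (simp add: g gsi_vector_def g_interval_def S_def image_image gradient_def)
        then show ?thesis using box[OF S near2 _ g\<nu> that] by simp
      qed
      let ?d = "- (inverse (norm g) *\<^sub>R g)"
      have g0: "0 < norm g" using g\<nu> par(1) by linarith
      have d: "norm ?d = 1" using g0 by simp
      have dir: "gradient f y \<bullet> ?d \<le> - (c' * norm g)" if "y \<in> D" "y \<in> ball x \<epsilon>" for y
      proof -
        have "c' * (norm g)\<^sup>2 \<le> gradient f y \<bullet> g"
          using that by (intro inner) (auto simp: \<Gamma>_def P_def)
        then have "inverse (norm g) * (c' * (norm g)\<^sup>2) \<le> inverse (norm g) * (gradient f y \<bullet> g)"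
          using g0 by (intro mult_left_mono) auto
        moreover have "inverse (norm g) * (c' * (norm g)\<^sup>2) = c' * norm g"
          using g0 by (simp add: power2_eq_square)
        ultimately show ?thesis by simp
      qed
      have "lbals f x g ?d \<epsilon> \<gamma> c \<noteq> 0"
      proof (rule lbals_nonzero)
        fix t assume t: "0 < t" "t \<le> \<epsilon> / 3"
        then have "t * norm ?d < \<epsilon>" unfolding d using par(2) by linarith
        from gradient_bound_imp_increment_bound[OF lip continuous_on_f open_D full_measure
            differentiable_D continuous_gradient dir t(1) this]
        have "f (x + t *\<^sub>R ?d) - f x \<le> - (c' * norm g) * t" .
        also have "\<dots> < - (c * t * norm g)"
          using c'(1) t(1) g0 by (simp add: mult.commute mult.left_commute)
        finally show "f (x + t *\<^sub>R ?d) - f x < - (c * t * norm g)" .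
      qed (use par in auto)
      then show ?thesis ..
    qed simp
  qed
qed

end

subsection \<open>Runs of the algorithm\<close>

text \<open>Radius and tolerance are fixed only for running states, since a reduction puts both
  below their thresholds and ends the loop. Differentiability at the iterate matters because the
  iterate is itself a sample point.\<close>

definition gsi_invariant :: "(real^'n \<Rightarrow> real) \<Rightarrow> real \<Rightarrow> real \<Rightarrow> (real^'n) gsi_state \<Rightarrow> bool" where
  "gsi_invariant f \<nu> \<epsilon> \<sigma> \<longleftrightarrow> f differentiable (at (iterate \<sigma>)) \<and>
     (gsi_continues \<nu> \<epsilon> \<sigma> \<longrightarrow> radius \<sigma> = \<epsilon> \<and> tolerance \<sigma> = \<nu>)"

lemma gsi_step_cases:
  assumes "gsi_step f m \<nu> \<epsilon> \<theta> \<mu> \<gamma> c u \<sigma> \<sigma>'"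
  obtains "\<sigma>' = \<sigma>" | "\<sigma>' = \<sigma>\<lparr>stopped := True\<rparr>"
    | "\<sigma>' = \<sigma>\<lparr>tolerance := \<theta> * tolerance \<sigma>, radius := \<mu> * radius \<sigma>\<rparr>" "gsi_continues \<nu> \<epsilon> \<sigma>"
    | z where "f differentiable (at z)" "\<sigma>' = \<sigma>\<lparr>iterate := z\<rparr>"
  using assms unfolding gsi_step_def Let_def by metis

lemma gsi_step_invariant:
  assumes "gsi_step f m \<nu> \<epsilon> \<theta> \<mu> \<gamma> c u \<sigma> \<sigma>'" "gsi_invariant f \<nu> \<epsilon> \<sigma>"
    "0 < \<nu>" "0 < \<epsilon>" "\<theta> < 1" "\<mu> < 1"
  shows "gsi_invariant f \<nu> \<epsilon> \<sigma>'"
  using assms(1)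
proof (cases rule: gsi_step_cases)
  case 3
  then have "tolerance \<sigma> = \<nu>" "radius \<sigma> = \<epsilon>"
    using assms(2) by (simp_all add: gsi_invariant_def)
  then show ?thesis
    using 3 assms(2-) by (simp add: gsi_invariant_def gsi_continues_def)
qed (use assms(2) in \<open>auto simp: gsi_invariant_def gsi_continues_def\<close>)

text \<open>A replacement point is required to satisfy the same Armijo inequality as the trial
  point, so both branches give the drop; then the step length exceeds the cut-off and
  \<open>norm g\<close> exceeds \<nu>.\<close>

lemma gsi_step_serious:
  assumes "gsi_step f m \<nu> \<epsilon> \<theta> \<mu> \<gamma> c u \<sigma> \<sigma>'" "gsi_invariant f \<nu> \<epsilon> \<sigma>"
    "gsi_serious f m \<nu> \<epsilon> \<gamma> c u \<sigma>"
    and par: "0 < \<nu>" "0 < \<epsilon>" "0 < \<gamma>" "\<gamma> < 1" "0 < c"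
  shows "f (iterate \<sigma>') + c * \<nu> * min 1 (\<gamma> * \<epsilon> / 3) \<le> f (iterate \<sigma>)"
proof -
  define x where "x = iterate \<sigma>"
  define g where "g = gsi_vector f m (sample_point x \<epsilon> u) \<nu>"
  define d where "d = - (inverse (norm g) *\<^sub>R g)"
  define t where "t = lbals f x g d \<epsilon> \<gamma> c"
  have rt: "radius \<sigma> = \<epsilon>" "tolerance \<sigma> = \<nu>" and cont: "gsi_continues \<nu> \<epsilon> \<sigma>"
    using assms(2,3) by (auto simp: gsi_invariant_def gsi_serious_def Let_def)
  have s: "\<forall>j\<in>{0..m}. f differentiable (at (sample_point x \<epsilon> u j))" "\<nu> < norm g" "t \<noteq> 0"
    using assms(3) by (simp_all add: gsi_serious_def Let_def rt t_def d_def g_def x_def)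
  have t: "min 1 (\<gamma> * \<epsilon> / 3) < t" "f (x + t *\<^sub>R d) - f x < - (c * t * norm g)"
    using lbals_zero_or_decrease[OF par(2-4), of f x g d c] s(3) by (auto simp: t_def)
  have "f (iterate \<sigma>') - f x < - (c * t * norm g)"
  proof (cases "f differentiable (at (x + t *\<^sub>R d))")
    case True
    then have "\<sigma>' = \<sigma>\<lparr>iterate := x + t *\<^sub>R d\<rparr>"
      using assms(1) cont s unfolding gsi_step_def Let_def rt
      by (fold x_def, fold g_def, fold d_def, fold t_def) auto
    then show ?thesis using t(2) by simp
  next
    case False
    then have "\<exists>z. f z - f x < - (c * t * norm g) \<and> \<sigma>' = \<sigma>\<lparr>iterate := z\<rparr>"
      using assms(1) cont s unfolding gsi_step_def Let_def rt
      by (fold x_def, fold g_def, fold d_def, fold t_def) auto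
    then show ?thesis by auto
  qed
  moreover have "c * min 1 (\<gamma> * \<epsilon> / 3) * \<nu> \<le> c * t * norm g"
  proof (intro mult_mono)
    have "0 \<le> min 1 (\<gamma> * \<epsilon> / 3)" using par by simp
    with t(1) have "0 \<le> t" by linarith
    then show "0 \<le> c * t" using par by simp
  qed (use t(1) s(2) par in auto)
  ultimately show ?thesis by (simp add: x_def mult_ac)
qed

text \<open>In a null iteration the trial point is the old iterate, where \<open>f\<close> is
  differentiable by the invariant, so the replacement branch cannot move it.\<close>

lemma gsi_step_not_serious:
  assumes "gsi_step f m \<nu> \<epsilon> \<theta> \<mu> \<gamma> c u \<sigma> \<sigma>'" "gsi_invariant f \<nu> \<epsilon> \<sigma>"
    "\<not> gsi_serious f m \<nu> \<epsilon> \<gamma> c u \<sigma>"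
  shows "iterate \<sigma>' = iterate \<sigma>"
  using assms unfolding gsi_step_def gsi_serious_def gsi_invariant_def Let_def
  by (auto split: if_splits)

lemma gsi_step_not_stopped:
  assumes "gsi_step f m \<nu> \<epsilon> \<theta> \<mu> \<gamma> c u \<sigma> \<sigma>'" "gsi_invariant f \<nu> \<epsilon> \<sigma>" "\<not> stopped \<sigma>"
    and "\<And>j. j \<in> {1..m} \<Longrightarrow> f differentiable (at (iterate \<sigma> + \<epsilon> *\<^sub>R u j))"
  shows "\<not> stopped \<sigma>'"
proof (cases "gsi_continues \<nu> \<epsilon> \<sigma>")
  case True
  then have "\<not> (\<exists>j\<in>{0..m}. \<not> f differentiable (at (sample_point (iterate \<sigma>) (radius \<sigma>) u j)))"
    using assms(2,4) by (auto simp: gsi_invariant_def sample_point_def)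
  then show ?thesis
    using assms(1,3) unfolding gsi_step_def Let_def by (auto split: if_splits)
next
  case False
  then show ?thesis using assms(1,3) unfolding gsi_step_def Let_def by simp
qed

text \<open>The alternative \<open>norm g \<le> \<nu>\<close> would trigger a reduction, after which
  the loop does not continue; so the line search was performed, and with success.\<close>

lemma gsi_step_accepted:
  assumes "gsi_step f m \<nu> \<epsilon> \<theta> \<mu> \<gamma> c u \<sigma> \<sigma>'" "gsi_invariant f \<nu> \<epsilon> \<sigma>"
    "gsi_continues \<nu> \<epsilon> \<sigma>" "gsi_continues \<nu> \<epsilon> \<sigma>'"
    and "\<And>j. j \<in> {1..m} \<Longrightarrow> f differentiable (at (iterate \<sigma> + \<epsilon> *\<^sub>R u j))"
    and g: "g = gsi_vector f m (sample_point (iterate \<sigma>) \<epsilon> u) \<nu>"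
    and "norm g \<le> \<nu> \<or> lbals f (iterate \<sigma>) g (- (inverse (norm g) *\<^sub>R g)) \<epsilon> \<gamma> c \<noteq> 0"
    and par: "0 < \<nu>" "0 < \<epsilon>" "\<theta> < 1" "\<mu> < 1"
  shows "gsi_serious f m \<nu> \<epsilon> \<gamma> c u \<sigma>"
proof -
  have rt: "radius \<sigma> = \<epsilon>" "tolerance \<sigma> = \<nu>" "f differentiable (at (iterate \<sigma>))"
    using assms(2,3) by (auto simp: gsi_invariant_def)
  have diff: "\<forall>j\<in>{0..m}. f differentiable (at (sample_point (iterate \<sigma>) \<epsilon> u j))"
    using rt(3) assms(5) by (auto simp: sample_point_def)
  have "\<not> norm g \<le> \<nu>"
  proof
    assume "norm g \<le> \<nu>"
    then have "\<sigma>' = \<sigma>\<lparr>tolerance := \<theta> * \<nu>, radius := \<mu> * \<epsilon>\<rparr>"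
      using assms(1,3) diff unfolding gsi_step_def Let_def rt g by auto
    then show False using assms(4) par by (simp add: gsi_continues_def)
  qed
  then show ?thesis
    using assms(3,7) diff unfolding gsi_serious_def Let_def rt g by auto
qed

lemma card_le_of_initial_segments:
  fixes S :: "nat set"
  assumes "\<And>K. card (S \<inter> {..<K}) \<le> B"
  shows "finite S" "card S \<le> B"
proof -
  have *: "card T \<le> B" if "finite T" "T \<subseteq> S" for T
  proof -
    have "\<exists>K. T \<subseteq> {..<K}" using that(1) by (rule finite_nat_bounded)
    then obtain K where "T \<subseteq> {..<K}" ..
    then have "card T \<le> card (S \<inter> {..<K})" using \<open>T \<subseteq> S\<close> by (intro card_mono) auto
    then show ?thesis using assms[of K] by linarith
  qed
  show "finite S"
  proof (rule ccontr)
    assume "infinite S"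
    then obtain T where "finite T" "card T = Suc B" "T \<subseteq> S"
      using infinite_arbitrarily_large by blast
    then show False using *[of T] by simp
  qed
  then show "card S \<le> B" using *[of S] by simp
qed

text \<open>One outcome of the sampling is fixed; everything in this locale is
  deterministic.\<close>

locale gsi_fixed_tolerances =
  fixes f :: "real^'n \<Rightarrow> real" and x0 :: "real^'n" and f_l \<nu> \<epsilon> \<theta> \<mu> \<gamma> c :: real and m :: nat
    and u :: "nat \<Rightarrow> nat \<Rightarrow> real^'n" and \<sigma> :: "nat \<Rightarrow> (real^'n) gsi_state"
  assumes bounded_below: "\<And>x. f_l \<le> f x"
    and start: "f differentiable (at x0)"
    and params: "0 < \<nu>" "0 < \<epsilon>" "\<theta> < 1" "\<mu> < 1" "0 < \<gamma>" "\<gamma> < 1" "0 < c"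
    and run: "gsi_run f x0 \<epsilon> \<nu> m \<nu> \<epsilon> \<theta> \<mu> \<gamma> c u \<sigma>"
begin

abbreviation serious_iterations :: "nat set" where
  "serious_iterations \<equiv> {k. gsi_serious f m \<nu> \<epsilon> \<gamma> c (u k) (\<sigma> k)}"

lemma step: "gsi_step f m \<nu> \<epsilon> \<theta> \<mu> \<gamma> c (u k) (\<sigma> k) (\<sigma> (Suc k))"
  and init: "\<sigma> 0 = \<lparr>iterate = x0, radius = \<epsilon>, tolerance = \<nu>, stopped = False\<rparr>"
  using run by (auto simp: gsi_run_def)

lemma invariant: "gsi_invariant f \<nu> \<epsilon> (\<sigma> k)"
proof (induction k)
  case 0
  then show ?case using start by (simp add: init gsi_invariant_def)
next
  case (Suc k)
  then show ?case using gsi_step_invariant[OF step] params by blast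
qed

lemma total_decrease:
  "f (iterate (\<sigma> K)) + c * \<nu> * min 1 (\<gamma> * \<epsilon> / 3) * real (card (serious_iterations \<inter> {..<K})) \<le> f x0"
proof (induction K)
  case 0
  then show ?case by (simp add: init)
next
  case (Suc K)
  show ?case
  proof (cases "K \<in> serious_iterations")
    case True
    then have "serious_iterations \<inter> {..<Suc K} = insert K (serious_iterations \<inter> {..<K})"
      by (auto simp: less_Suc_eq)
    then have "card (serious_iterations \<inter> {..<Suc K}) = Suc (card (serious_iterations \<inter> {..<K}))"
      by simp
    moreover have "f (iterate (\<sigma> (Suc K))) + c * \<nu> * min 1 (\<gamma> * \<epsilon> / 3) \<le> f (iterate (\<sigma> K))"
      using True by (intro gsi_step_serious[OF step invariant]) (use params in auto)
    ultimately show ?thesis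
      using Suc.IH by (simp only: of_nat_Suc distrib_left mult_1_right)
  next
    case False
    then have "serious_iterations \<inter> {..<Suc K} = serious_iterations \<inter> {..<K}"
      by (auto simp: less_Suc_eq)
    moreover have "iterate (\<sigma> (Suc K)) = iterate (\<sigma> K)"
      using False by (intro gsi_step_not_serious[OF step invariant]) simp
    ultimately show ?thesis using Suc.IH by simp
  qed
qed

lemma serious_iterations_bound:
  "finite serious_iterations"
  "int (card serious_iterations) \<le> \<lfloor>(f x0 - f_l) / (c * \<nu> * min 1 (\<gamma> * \<epsilon> / 3))\<rfloor>"
proof -
  let ?a = "c * \<nu> * min 1 (\<gamma> * \<epsilon> / 3)"
  have a: "0 < ?a" using params by simp
  have "real (card (serious_iterations \<inter> {..<K})) \<le> (f x0 - f_l) / ?a" for K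
  proof -
    have "?a * real (card (serious_iterations \<inter> {..<K})) \<le> f x0 - f_l"
      using total_decrease[of K] bounded_below[of "iterate (\<sigma> K)"] by linarith
    then show ?thesis using a by (simp only: pos_le_divide_eq mult.commute)
  qed
  then have le: "int (card (serious_iterations \<inter> {..<K})) \<le> \<lfloor>(f x0 - f_l) / ?a\<rfloor>" for K
    by (simp add: le_floor_iff)
  then have "card (serious_iterations \<inter> {..<K}) \<le> nat \<lfloor>(f x0 - f_l) / ?a\<rfloor>" for K
    using nat_mono[OF le[of K]] by simp
  note bound = card_le_of_initial_segments[OF this]
  show "finite serious_iterations" by (rule bound(1))
  have "0 \<le> \<lfloor>(f x0 - f_l) / ?a\<rfloor>" using le[of 0] by simp
  then show "int (card serious_iterations) \<le> \<lfloor>(f x0 - f_l) / ?a\<rfloor>"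
    using bound(2) by (metis le_nat_iff)
qed

text \<open>Without termination the run never stops, and after its last serious iteration the
  iterate is frozen. An accepted sample for this point in a later pass would make that pass serious.
  The point and the pass \<open>K\<close> are known only from the whole run, so
  \<open>accepted\<close> is needed for all of them.\<close>

lemma terminates:
  assumes differentiable_samples:
      "\<And>k j. j \<in> {1..m} \<Longrightarrow> f differentiable (at (iterate (\<sigma> k) + \<epsilon> *\<^sub>R u k j))"
    and accepted: "\<And>x K. f differentiable (at x) \<Longrightarrow> \<exists>k\<ge>K. \<forall>g.
      g = gsi_vector f m (sample_point x \<epsilon> (u k)) \<nu> \<longrightarrow>
      norm g \<le> \<nu> \<or> lbals f x g (- (inverse (norm g) *\<^sub>R g)) \<epsilon> \<gamma> c \<noteq> 0"
  shows "gsi_terminates \<nu> \<epsilon> \<sigma>"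
proof (rule ccontr)
  assume not_term: "\<not> gsi_terminates \<nu> \<epsilon> \<sigma>"
  have "\<not> stopped (\<sigma> k)" for k
  proof (induction k)
    case 0
    then show ?case by (simp add: init)
  next
    case (Suc k)
    then show ?case using gsi_step_not_stopped[OF step invariant _ differentiable_samples] by blast
  qed
  then have cont: "gsi_continues \<nu> \<epsilon> (\<sigma> k)" for k
    using not_term by (auto simp: gsi_terminates_def gsi_continues_def not_less)
  obtain K where K: "serious_iterations \<subseteq> {..<K}"
    using finite_nat_bounded[OF serious_iterations_bound(1)] by blast
  have const: "iterate (\<sigma> (K + k)) = iterate (\<sigma> K)" for k
  proof (induction k)
    case (Suc k)
    have "\<not> gsi_serious f m \<nu> \<epsilon> \<gamma> c (u (K + k)) (\<sigma> (K + k))" using K by auto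
    from gsi_step_not_serious[OF step invariant this] Suc show ?case by simp
  qed simp
  have "f differentiable (at (iterate (\<sigma> K)))" using invariant by (simp add: gsi_invariant_def)
  from accepted[OF this, of K] obtain k where k: "K \<le> k"
    and acc: "\<And>g. g = gsi_vector f m (sample_point (iterate (\<sigma> K)) \<epsilon> (u k)) \<nu> \<Longrightarrow>
      norm g \<le> \<nu> \<or> lbals f (iterate (\<sigma> K)) g (- (inverse (norm g) *\<^sub>R g)) \<epsilon> \<gamma> c \<noteq> 0"
    by blast
  have it: "iterate (\<sigma> k) = iterate (\<sigma> K)" using const[of "k - K"] k by simp
  have "gsi_serious f m \<nu> \<epsilon> \<gamma> c (u k) (\<sigma> k)"
    by (rule gsi_step_accepted[OF step invariant cont cont differentiable_samples refl])
       (use acc[folded it] params in auto)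
  then show False using K k by auto
qed

end

subsection \<open>Almost sure behaviour of the samples\<close>

text \<open>The bad \<open>y\<close> lie in the image of a null set under an affine map, and
  differentiable maps of a Euclidean space into itself preserve null sets.\<close>

lemma full_measure_translate_scale:
  fixes D :: "'a::euclidean_space set"
  assumes "- D \<in> null_sets lebesgue" "\<epsilon> \<noteq> 0"
  shows "AE y in lborel. a + \<epsilon> *\<^sub>R y \<in> D"
proof -
  let ?h = "\<lambda>z. (1 / \<epsilon>) *\<^sub>R (z - a)"
  have "negligible (- D)"
    using assms(1) by (simp add: negligible_iff_null_sets)
  then have "negligible (?h ` (- D))"
    by (rule negligible_differentiable_image_negligible[OF order_refl]) (intro derivative_intros)
  moreover have "{y. \<not> a + \<epsilon> *\<^sub>R y \<in> D} \<subseteq> ?h ` (- D)"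
  proof
    fix y assume "y \<in> {y. \<not> a + \<epsilon> *\<^sub>R y \<in> D}"
    moreover have "y = ?h (a + \<epsilon> *\<^sub>R y)" using assms(2) by simp
    ultimately show "y \<in> ?h ` (- D)" by blast
  qed
  ultimately have "{y. \<not> a + \<epsilon> *\<^sub>R y \<in> D} \<in> null_sets lebesgue"
    using negligible_subset negligible_iff_null_sets by blast
  then have "AE y in lebesgue. a + \<epsilon> *\<^sub>R y \<in> D"
    by (auto dest: AE_not_in)
  then show ?thesis by (simp add: AE_completion_iff)
qed

context prob_space begin

text \<open>Fubini: for a fixed value of \<open>X\<close> the uniform law of \<open>U\<close> does
  not charge the null set, and independence makes the joint law a product.\<close>

lemma AE_sample_in_full_measure_set:
  fixes X U :: "'a \<Rightarrow> 'b::euclidean_space"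
  assumes indep: "indep_var borel X borel U"
    and U: "distr M borel U = uniform_measure lborel (cball 0 1)"
    and D: "open D" "- D \<in> null_sets lebesgue" and \<epsilon>: "\<epsilon> \<noteq> 0"
  shows "AE \<omega> in M. X \<omega> + \<epsilon> *\<^sub>R U \<omega> \<in> D"
proof -
  have X[measurable]: "random_variable borel X" and U'[measurable]: "random_variable borel U"
    and joint: "distr M borel X \<Otimes>\<^sub>M distr M borel U = distr M (borel \<Otimes>\<^sub>M borel) (\<lambda>\<omega>. (X \<omega>, U \<omega>))"
    using indep by (simp_all add: indep_var_distribution_eq)
  interpret X: prob_space "distr M borel X" by (rule prob_space_distr) fact
  interpret U: prob_space "distr M borel U" by (rule prob_space_distr) fact
  interpret XU: pair_prob_space "distr M borel X" "distr M borel U" ..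
  \<comment> \<open>Openness of \<open>D\<close> makes the joint event a Borel set, as the product
    argument demands.\<close>
  have "open {p::'b \<times> 'b. fst p + \<epsilon> *\<^sub>R snd p \<in> D}"
    by (rule open_vimage[OF D(1), unfolded vimage_def]) (intro continuous_intros)
  then have meas: "{p::'b \<times> 'b. fst p + \<epsilon> *\<^sub>R snd p \<in> D} \<in> sets (borel \<Otimes>\<^sub>M borel)"
    unfolding borel_prod by (rule borel_open)
  have "AE p in distr M borel X \<Otimes>\<^sub>M distr M borel U. fst p + \<epsilon> *\<^sub>R snd p \<in> D"
  proof (rule XU.AE_pair_measure)
    show "AE x in distr M borel X. AE y in distr M borel U. fst (x, y) + \<epsilon> *\<^sub>R snd (x, y) \<in> D"
      unfolding U fst_conv snd_conv
    proof (rule AE_I2, rule AE_uniform_measureI)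
      fix x
      show "AE y in lborel. y \<in> cball 0 1 \<longrightarrow> x + \<epsilon> *\<^sub>R y \<in> D"
        using full_measure_translate_scale[OF D(2) \<epsilon>, of x] by eventually_elim simp
    qed simp
  qed (use meas in \<open>simp add: space_pair_measure\<close>)
  then have "AE p in distr M (borel \<Otimes>\<^sub>M borel) (\<lambda>\<omega>. (X \<omega>, U \<omega>)). fst p + \<epsilon> *\<^sub>R snd p \<in> D"
    unfolding joint .
  from AE_distrD[OF _ this] show ?thesis by simp
qed

text \<open>A nonempty open part of the ball has positive volume. The quotient involves
  \<open>W\<close> but not \<open>U\<close>, so every pass has the same chance of a hit.\<close>

lemma prob_sample_in_open_pos:
  fixes U :: "'a \<Rightarrow> 'b::euclidean_space"
  assumes U': "random_variable borel U" and U: "distr M borel U = uniform_measure lborel (cball 0 1)"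
    and W: "open W" "W \<inter> ball 0 1 \<noteq> {}"
  shows "prob (U -` W \<inter> space M) = measure lborel (cball 0 1 \<inter> W) / measure lborel (cball (0::'b) 1)"
    "0 < measure lborel (cball 0 1 \<inter> W) / measure lborel (cball (0::'b) 1)"
proof -
  have fin: "emeasure lborel (cball (0::'b) 1) \<noteq> \<infinity>" "emeasure lborel (cball (0::'b) 1 \<inter> W) \<noteq> \<infinity>"
    using emeasure_lborel_cball_finite emeasure_bounded_finite[of "cball 0 1 \<inter> W"]
    by (auto simp: bounded_Int less_top[symmetric])
  have pos: "0 < measure lborel S" if "ball 0 1 \<inter> W \<subseteq> S" "S \<in> sets borel" "emeasure lborel S \<noteq> \<infinity>" for S :: "'b set"
  proof (rule ccontr)
    assume "\<not> 0 < measure lborel S"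
    then have "measure lborel S = 0"
      using measure_nonneg[of lborel S] by linarith
    then have "S \<in> null_sets lborel"
      using that by (auto simp: measure_eq_0_null_sets measure_def enn2real_eq_0_iff null_sets_def)
    then have "S \<in> null_sets lebesgue" by (rule null_sets_completionI)
    then have "negligible (ball 0 1 \<inter> W)"
      using that(1) negligible_subset negligible_iff_null_sets by blast
    then show False using open_not_negligible[of "ball 0 1 \<inter> W"] W by (auto simp: Int_commute)
  qed
  have 1: "0 < measure lborel (cball (0::'b) 1)" "0 < measure lborel (cball 0 1 \<inter> W)"
    using W fin by (auto intro!: pos)
  then show "0 < measure lborel (cball 0 1 \<inter> W) / measure lborel (cball (0::'b) 1)" by simp
  have "prob (U -` W \<inter> space M) = measure (distr M borel U) W"
    using U' W by (simp add: measure_distr)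
  also have "\<dots> = measure lborel (cball 0 1 \<inter> W) / measure lborel (cball (0::'b) 1)"
    unfolding U using 1 W fin by (subst measure_uniform_measure) (auto simp: measure_def emeasure_eq_0_AE)
  finally show "prob (U -` W \<inter> space M) = measure lborel (cball 0 1 \<inter> W) / measure lborel (cball (0::'b) 1)" .
qed

text \<open>The samples of one pass form a block; the blocks are independent and each hits the
  product with the same probability \<open>p > 0\<close>. Hence \<open>N + 1\<close> successive
  misses have probability \<open>(1 - p) ^ Suc N\<close>, which tends to 0.\<close>

lemma AE_samples_visit_product:
  fixes u :: "nat \<Rightarrow> nat \<Rightarrow> 'a \<Rightarrow> 'b::euclidean_space"
  assumes indep: "indep_vars (\<lambda>_. borel) (\<lambda>(k, j). u k j) (UNIV \<times> {1..m})" and m: "1 \<le> m"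
    and unif: "\<And>k j. j \<in> {1..m} \<Longrightarrow> distr M borel (u k j) = uniform_measure lborel (cball 0 1)"
    and W: "\<And>j. j \<in> {1..m} \<Longrightarrow> open (W j)" "\<And>j. j \<in> {1..m} \<Longrightarrow> W j \<inter> ball 0 1 \<noteq> {}"
  shows "AE \<omega> in M. \<forall>K. \<exists>k\<ge>K. \<forall>j\<in>{1..m}. u k j \<omega> \<in> W j"
proof -
  have rv: "random_variable borel (u k j)" if "j \<in> {1..m}" for k j
    using indep that by (auto simp: indep_vars_def)
  define p where "p = (\<Prod>j\<in>{1..m}. measure lborel (cball 0 1 \<inter> W j) / measure lborel (cball (0::'b) 1))"
  have p_pos: "0 < p"
    unfolding p_def using prob_sample_in_open_pos(2)[OF rv unif W] by (intro prod_pos) blast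
  let ?I = "\<lambda>k::nat. {k} \<times> {1..m}"
  define Y where "Y k \<omega> = (\<lambda>i\<in>?I k. (case i of (k, j) \<Rightarrow> u k j) \<omega>)" for k \<omega>
  have Y: "indep_vars (\<lambda>k. PiM (?I k) (\<lambda>_. borel)) Y UNIV"
    unfolding Y_def by (rule indep_vars_restrict[OF indep]) (auto simp: disjoint_family_on_def)
  define A where "A k = PiE (?I k) (\<lambda>i. W (snd i))" for k
  \<comment> \<open>A miss is written as the preimage of a measurable set under \<open>Y k\<close>,
    so that independence of the blocks applies to it.\<close>
  define B where "B k = space (PiM (?I k) (\<lambda>_. borel :: 'b measure)) - A k" for k
  have A_sets: "A k \<in> sets (PiM (?I k) (\<lambda>_. borel))" for k
    unfolding A_def using W(1) by (intro sets_PiM_I_finite) auto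
  then have B_sets: "B k \<in> sets (PiM (?I k) (\<lambda>_. borel))" for k
    unfolding B_def by blast
  have Y_rv: "Y k \<in> measurable M (PiM (?I k) (\<lambda>_. borel))" for k
    using Y by (auto simp: indep_vars_def)
  have YA: "Y k -` A k \<inter> space M = (\<Inter>i\<in>?I k. (case i of (k, j) \<Rightarrow> u k j) -` W (snd i) \<inter> space M)" for k
    using m by (auto simp: Y_def A_def PiE_iff)
  have prob_A: "prob (Y k -` A k \<inter> space M) = p" for k
  proof -
    have "prob (Y k -` A k \<inter> space M) = (\<Prod>i\<in>?I k. prob ((case i of (k, j) \<Rightarrow> u k j) -` W (snd i) \<inter> space M))"
      unfolding YA by (rule indep_varsD[OF indep]) (use m W(1) in auto)
    also have "\<dots> = (\<Prod>j\<in>{1..m}. prob (u k j -` W j \<inter> space M))"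
      by (rule prod.reindex_bij_witness[of _ "\<lambda>j. (k, j)" snd]) auto
    also have "\<dots> = p"
      unfolding p_def by (rule prod.cong[OF refl]) (use prob_sample_in_open_pos(1)[OF rv unif W] in blast)
    finally show ?thesis .
  qed
  have p_le: "p \<le> 1" using prob_A[of 0, symmetric] by simp
  have prob_B: "prob (Y k -` B k \<inter> space M) = 1 - p" for k
  proof -
    have "Y k -` B k \<inter> space M = space M - (Y k -` A k \<inter> space M)"
      using measurable_space[OF Y_rv] by (auto simp: B_def)
    then show ?thesis
      using prob_compl[OF measurable_sets[OF Y_rv A_sets]] prob_A by simp
  qed
  have "AE \<omega> in M. \<exists>k\<ge>K. \<forall>j\<in>{1..m}. u k j \<omega> \<in> W j" for K
  proof -
    define E where "E = (\<Inter>k\<in>{K..}. Y k -` B k \<inter> space M)"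
    have E_sets: "E \<in> events"
      unfolding E_def by (intro sets.countable_INT') (auto intro!: measurable_sets[OF Y_rv B_sets])
    have "prob E \<le> (1 - p) ^ Suc N" for N
    proof -
      have "prob E \<le> prob (\<Inter>k\<in>{K..K+N}. Y k -` B k \<inter> space M)"
        unfolding E_def
        by (intro finite_measure_mono sets.finite_INT) (auto intro!: measurable_sets[OF Y_rv B_sets])
      also have "\<dots> = (\<Prod>k\<in>{K..K+N}. prob (Y k -` B k \<inter> space M))"
        by (rule indep_varsD[OF Y]) (use B_sets in auto)
      also have "\<dots> = (1 - p) ^ Suc N" by (simp add: prob_B)
      finally show ?thesis .
    qed
    moreover have "(\<lambda>N. (1 - p) ^ Suc N) \<longlonglongrightarrow> 0"
      using p_pos p_le by (intro LIMSEQ_Suc LIMSEQ_realpow_zero) auto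
    ultimately have "prob E \<le> 0"
      by (intro LIMSEQ_le_const) auto
    then have "prob E = 0" by (simp add: measure_le_0_iff)
    then have "E \<in> null_sets M"
      using E_sets by (simp add: emeasure_eq_measure null_sets_def)
    then have "AE \<omega> in M. \<omega> \<notin> E" by (rule AE_not_in)
    then show ?thesis
      using AE_space
    proof eventually_elim
      fix \<omega> assume \<omega>: "\<omega> \<notin> E" "\<omega> \<in> space M"
      then obtain k where k: "k \<ge> K" "Y k \<omega> \<notin> B k" by (auto simp: E_def)
      then have "Y k \<omega> \<in> A k"
        using measurable_space[OF Y_rv \<omega>(2), of k] by (simp add: B_def)
      then have "\<omega> \<in> Y k -` A k \<inter> space M" using \<omega>(2) by simp
      then show "\<exists>k\<ge>K. \<forall>j\<in>{1..m}. u k j \<omega> \<in> W j"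
        unfolding YA using k(1) by auto
    qed
  qed
  then show ?thesis by (simp add: AE_all_countable)
qed

text \<open>The exceptional null set does not depend on the open sets, so that these may later be chosen
  depending on the outcome: a countable basis suffices.\<close>

lemma AE_samples_visit_all_products:
  fixes u :: "nat \<Rightarrow> nat \<Rightarrow> 'a \<Rightarrow> 'b::euclidean_space"
  assumes indep: "indep_vars (\<lambda>_. borel) (\<lambda>(k, j). u k j) (UNIV \<times> {1..m})" and m: "1 \<le> m"
    and unif: "\<And>k j. j \<in> {1..m} \<Longrightarrow> distr M borel (u k j) = uniform_measure lborel (cball 0 1)"
  shows "AE \<omega> in M. \<forall>V. (\<forall>j. open (V j) \<and> V j \<noteq> {} \<and> V j \<subseteq> ball 0 1) \<longrightarrow>
    (\<forall>K. \<exists>k\<ge>K. \<forall>j\<in>{1..m}. u k j \<omega> \<in> V j)"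
proof -
  obtain \<B> :: "'b set set" where \<B>: "countable \<B>" "topological_basis \<B>"
    using ex_countable_basis by blast
  \<comment> \<open>\<open>PiE\<close> pins the values outside \<open>{1..m}\<close>, which keeps
    the family countable.\<close>
  define \<W> where "\<W> = PiE {1..m} (\<lambda>_. {b \<in> \<B>. b \<inter> ball 0 1 \<noteq> {}})"
  have "countable \<W>"
    unfolding \<W>_def using \<B>(1) by (intro countable_PiE) auto
  moreover have "AE \<omega> in M. \<forall>K. \<exists>k\<ge>K. \<forall>j\<in>{1..m}. u k j \<omega> \<in> W j" if "W \<in> \<W>" for W
  proof (rule AE_samples_visit_product[OF indep m unif])
    fix j assume "j \<in> {1..m}"
    with that have "W j \<in> \<B>" "W j \<inter> ball 0 1 \<noteq> {}" by (auto simp: \<W>_def PiE_iff)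
    then show "open (W j)" "W j \<inter> ball 0 1 \<noteq> {}"
      using topological_basis_open[OF \<B>(2)] by auto
  qed
  ultimately have "AE \<omega> in M. \<forall>W\<in>\<W>. \<forall>K. \<exists>k\<ge>K. \<forall>j\<in>{1..m}. u k j \<omega> \<in> W j"
    by (simp add: AE_ball_countable)
  then show ?thesis
  proof eventually_elim
    fix \<omega> assume \<omega>: "\<forall>W\<in>\<W>. \<forall>K. \<exists>k\<ge>K. \<forall>j\<in>{1..m}. u k j \<omega> \<in> W j"
    show "\<forall>V. (\<forall>j. open (V j) \<and> V j \<noteq> {} \<and> V j \<subseteq> ball 0 1) \<longrightarrow>
      (\<forall>K. \<exists>k\<ge>K. \<forall>j\<in>{1..m}. u k j \<omega> \<in> V j)"
    proof (intro allI impI)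
      fix V :: "nat \<Rightarrow> 'b set" and K
      assume V: "\<forall>j. open (V j) \<and> V j \<noteq> {} \<and> V j \<subseteq> ball 0 1"
      have "\<exists>b\<in>\<B>. b \<noteq> {} \<and> b \<subseteq> V j" for j
      proof -
        obtain y where "y \<in> V j" using V by blast
        then obtain b where "b \<in> \<B>" "y \<in> b" "b \<subseteq> V j"
          using topological_basisE[OF \<B>(2)] V by metis
        then show ?thesis by blast
      qed
      then obtain b where b: "\<And>j. b j \<in> \<B>" "\<And>j. b j \<noteq> {}" "\<And>j. b j \<subseteq> V j" by metis
      have "b j \<inter> ball 0 1 \<noteq> {}" for j using b(2,3)[of j] V by blast
      then have "restrict b {1..m} \<in> \<W>" using b(1) by (auto simp: \<W>_def)
      then obtain k where "k \<ge> K" "\<forall>j\<in>{1..m}. u k j \<omega> \<in> restrict b {1..m} j" using \<omega> by blast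
      then show "\<exists>k\<ge>K. \<forall>j\<in>{1..m}. u k j \<omega> \<in> V j" using b(3) by (intro exI[of _ k]) auto
    qed
  qed
qed

end

subsection \<open>The bound\<close>

text \<open>The process \<sigma> is any one that follows the step relation for each outcome. Since
  that relation would let a replacement point anticipate later samples, \<open>fresh_samples\<close>
  states that the samples of a pass are drawn independently of its iterate.\<close>

theorem corollary5p2:
  fixes f :: "real^'n \<Rightarrow> real" and D :: "(real^'n) set" and x0 :: "real^'n"
    and f_l \<nu> \<epsilon> \<theta> \<mu> \<gamma> c :: real and m :: nat
    and M :: "'w measure"
    and u :: "nat \<Rightarrow> nat \<Rightarrow> 'w \<Rightarrow> real^'n"
    and \<sigma> :: "nat \<Rightarrow> 'w \<Rightarrow> (real^'n) gsi_state"
  assumes locally_lipschitz: "\<And>x. \<exists>r>0. \<exists>L. L-lipschitz_on (ball x r) f"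
    and open_D: "open D"
    and full_measure: "- D \<in> null_sets lebesgue"
    and differentiable_D: "\<And>x. x \<in> D \<Longrightarrow> f differentiable (at x)"
    and continuous_gradient: "continuous_on D (gradient f)"
    and bounded_below: "\<And>x. f_l \<le> f x"
    and start: "f differentiable (at x0)"
    and params: "\<nu> > 0" "\<epsilon> > 0" "\<theta> \<in> {0<..<1}" "\<mu> \<in> {0<..<1}" "\<gamma> \<in> {0<..<1}" "c \<in> {0<..<1}"
    and sample_size: "m = 4 * CARD('n)"
    and prob: "prob_space M"
    and samples_indep: "prob_space.indep_vars M (\<lambda>_. borel) (\<lambda>(k, j). u k j) (UNIV \<times> {1..m})"
    and samples_uniform:
      "\<And>k j. j \<in> {1..m} \<Longrightarrow> distr M borel (u k j) = uniform_measure lborel (cball 0 1)"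
    and run: "\<And>\<omega>. \<omega> \<in> space M \<Longrightarrow>
      gsi_run f x0 \<epsilon> \<nu> m \<nu> \<epsilon> \<theta> \<mu> \<gamma> c (\<lambda>k j. u k j \<omega>) (\<lambda>k. \<sigma> k \<omega>)"
    and fresh_samples: "\<And>k j. j \<in> {1..m} \<Longrightarrow>
      prob_space.indep_var M borel (\<lambda>\<omega>. iterate (\<sigma> k \<omega>)) borel (u k j)"
  shows "AE \<omega> in M.
    (\<gamma> * \<epsilon> < 3 \<longrightarrow> gsi_terminates \<nu> \<epsilon> (\<lambda>k. \<sigma> k \<omega>)) \<and>
    finite {k. gsi_serious f m \<nu> \<epsilon> \<gamma> c (\<lambda>j. u k j \<omega>) (\<sigma> k \<omega>)} \<and>
    int (card {k. gsi_serious f m \<nu> \<epsilon> \<gamma> c (\<lambda>j. u k j \<omega>) (\<sigma> k \<omega>)})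
      \<le> \<lfloor>(f x0 - f_l) / (c * \<nu> * min 1 (\<gamma> * \<epsilon> / 3))\<rfloor> + 1"
proof -
  interpret prob_space M by (rule prob)
  interpret F: locally_lipschitz_almost_C1 f D
    by unfold_locales
      (fact locally_lipschitz open_D full_measure differentiable_D continuous_gradient)+
  have m1: "1 \<le> m" unfolding sample_size by (simp add: Suc_leI)
  have "AE \<omega> in M. \<forall>k. \<forall>j\<in>{1..m}. iterate (\<sigma> k \<omega>) + \<epsilon> *\<^sub>R u k j \<omega> \<in> D"
    unfolding AE_all_countable
  proof
    fix k
    have "AE \<omega> in M. iterate (\<sigma> k \<omega>) + \<epsilon> *\<^sub>R u k j \<omega> \<in> D" if "j \<in> {1..m}" for j
      using AE_sample_in_full_measure_set[OF fresh_samples[OF that] samples_uniform[OF that]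
          open_D full_measure, of \<epsilon>] params(2) by simp
    then show "AE \<omega> in M. \<forall>j\<in>{1..m}. iterate (\<sigma> k \<omega>) + \<epsilon> *\<^sub>R u k j \<omega> \<in> D"
      by (intro AE_finite_allI) auto
  qed
  moreover have "AE \<omega> in M. \<forall>V. (\<forall>j. open (V j) \<and> V j \<noteq> {} \<and> V j \<subseteq> ball 0 1) \<longrightarrow>
      (\<forall>K. \<exists>k\<ge>K. \<forall>j\<in>{1..m}. u k j \<omega> \<in> V j)"
    by (rule AE_samples_visit_all_products[OF samples_indep m1 samples_uniform])
  ultimately show ?thesis
    using AE_space
  proof eventually_elim
    fix \<omega>
    assume samples_D: "\<forall>k. \<forall>j\<in>{1..m}. iterate (\<sigma> k \<omega>) + \<epsilon> *\<^sub>R u k j \<omega> \<in> D"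
      and visit: "\<forall>V. (\<forall>j. open (V j) \<and> V j \<noteq> {} \<and> V j \<subseteq> ball 0 1) \<longrightarrow>
        (\<forall>K. \<exists>k\<ge>K. \<forall>j\<in>{1..m}. u k j \<omega> \<in> V j)"
      and \<omega>: "\<omega> \<in> space M"
    interpret G: gsi_fixed_tolerances f x0 f_l \<nu> \<epsilon> \<theta> \<mu> \<gamma> c m "\<lambda>k j. u k j \<omega>" "\<lambda>k. \<sigma> k \<omega>"
      by unfold_locales (use bounded_below start params run[OF \<omega>] in auto)
    have "gsi_terminates \<nu> \<epsilon> (\<lambda>k. \<sigma> k \<omega>)" if "\<gamma> * \<epsilon> < 3"
    proof (rule G.terminates)
      show "f differentiable (at (iterate (\<sigma> k \<omega>) + \<epsilon> *\<^sub>R u k j \<omega>))" if "j \<in> {1..m}" for k j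
        using samples_D that differentiable_D by blast
      fix x K assume x: "f differentiable (at x)"
      \<comment> \<open>These sets depend on \<open>x\<close>, hence on the outcome; this is
        legitimate because \<open>visit\<close> holds for all such families at once.\<close>
      obtain V where V: "\<And>j. open (V j)" "\<And>j. V j \<noteq> {}" "\<And>j. V j \<subseteq> ball 0 1"
        and acc: "\<And>v g. (\<And>j. j \<in> {1..m} \<Longrightarrow> v j \<in> V j) \<Longrightarrow>
          g = gsi_vector f m (sample_point x \<epsilon> v) \<nu> \<Longrightarrow>
          norm g \<le> \<nu> \<or> lbals f x g (- (inverse (norm g) *\<^sub>R g)) \<epsilon> \<gamma> c \<noteq> 0"
      proof (rule F.open_samples_accepted[of x \<nu> \<epsilon> \<gamma> c m], goal_cases)
        case (10 V)
        show ?case by (rule 10(1)[OF 10(2-)])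
      qed (use x params sample_size \<open>\<gamma> * \<epsilon> < 3\<close> in auto)
      obtain k where k: "K \<le> k" "\<forall>j\<in>{1..m}. u k j \<omega> \<in> V j"
        using visit V by blast
      show "\<exists>k\<ge>K. \<forall>g. g = gsi_vector f m (sample_point x \<epsilon> (\<lambda>j. u k j \<omega>)) \<nu> \<longrightarrow>
          norm g \<le> \<nu> \<or> lbals f x g (- (inverse (norm g) *\<^sub>R g)) \<epsilon> \<gamma> c \<noteq> 0"
        using k by (intro exI[of _ k] conjI allI impI acc[of "\<lambda>j. u k j \<omega>"]) auto
    qed
    then show "(\<gamma> * \<epsilon> < 3 \<longrightarrow> gsi_terminates \<nu> \<epsilon> (\<lambda>k. \<sigma> k \<omega>)) \<and>
      finite {k. gsi_serious f m \<nu> \<epsilon> \<gamma> c (\<lambda>j. u k j \<omega>) (\<sigma> k \<omega>)} \<and>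
      int (card {k. gsi_serious f m \<nu> \<epsilon> \<gamma> c (\<lambda>j. u k j \<omega>) (\<sigma> k \<omega>)})
        \<le> \<lfloor>(f x0 - f_l) / (c * \<nu> * min 1 (\<gamma> * \<epsilon> / 3))\<rfloor> + 1"
      using G.serious_iterations_bound by linarith
  qed
qed

end
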